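(* Let $(X,Z)$ be a pair of Banach spaces with property ( * ), let $A\subset X$ be a closed subset of $X$ and let $f:A\to Z$ be a mapping. Then $f$ satisfies the mean value condition if and only if there is a $C^1$ smooth mapping $G:X\to Z$ with $G|_A=f$.
   Context: Banach spaces are real; $C^1$ smooth means continuously Fréchet differentiable. $\mathcal{L}(X,Z)$ is the space of bounded linear maps $X\to Z$ with the operator norm. For a mapping $f:A\to Z$ with $A\subset X$, $\operatorname{Lip}(f)=\sup\{\|f(x)-f(y)\|/\|x-y\| : x,y\in A,\ x\neq y\}$ (equal to $0$ if $A$ has at most one point). Property ( * ): the pair $(X,Z)$ has property ( * ) if there is a constant $C_0\ge 1$, depending only on $X$ and $Z$, such that for every subset $A\subset X$, every Lipschitz mapping $f:A\to Z$ and every $\varepsilon>0$, there is a $C^1$ smooth and Lipschitz mapping $g:X\to Z$ such that $\|f(x)-g(x)\|<\varepsilon$ for all $x\in A$ and $\operatorname{Lip}(g)\le C_0\operatorname{Lip}(f)$. Mean value condition: a mapping $f:A\to Z$, with $A\subset X$ closed, satisfies the mean value condition if there exists a continuous map $D:A\to\mathcal{L}(X,Z)$ such that for every $y\in A$ and every $\varepsilon>0$ there is an open ball $B(y,r)$ in $X$ such that $\|f(z)-f(w)-D(y)(z-w)\|\le\varepsilon\|z-w\|$ for every $z,w\in A\cap B(y,r)$. *)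

theory Defs
  imports "HOL-Analysis.Analysis"
begin

text \<open>
  A mapping \<open>f : A \<rightarrow> Z\<close> is represented by a total function \<open>f\<close> together with the set \<open>A\<close>;
  the notions below depend only on the values of \<open>f\<close> on \<open>A\<close>.
\<close>

definition lipschitz_map_on :: "'a::real_normed_vector set \<Rightarrow> ('a \<Rightarrow> 'b::real_normed_vector) \<Rightarrow> bool"
  where "lipschitz_map_on A f \<longleftrightarrow> (\<exists>L. L-lipschitz_on A f)"

text \<open>
  All quotients are nonnegative, so inserting \<open>0\<close> only matters when \<open>A\<close> has at most one point,
  where it gives the value \<open>0\<close>. The supremum is real-valued, hence meaningful only
  for Lipschitz mappings.
\<close>

definition Lip :: "'a::real_normed_vector set \<Rightarrow> ('a \<Rightarrow> 'b::real_normed_vector) \<Rightarrow> real"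
  where "Lip A f =
    Sup (insert 0 {norm (f x - f y) / norm (x - y) | x y. x \<in> A \<and> y \<in> A \<and> x \<noteq> y})"

definition C1_smooth :: "('a::real_normed_vector \<Rightarrow> 'b::real_normed_vector) \<Rightarrow> bool"
  where "C1_smooth g \<longleftrightarrow>
    (\<exists>g' :: 'a \<Rightarrow> 'a \<Rightarrow>\<^sub>L 'b.
      (\<forall>x. (g has_derivative blinfun_apply (g' x)) (at x)) \<and> continuous_on UNIV g')"

text \<open>
  Property (*) of the pair \<open>(X, Z)\<close>; the spaces are types, passed as \<open>TYPE('a)\<close> and \<open>TYPE('b)\<close>.
\<close>

definition property_star :: "'a::banach itself \<Rightarrow> 'b::banach itself \<Rightarrow> bool"
  where "property_star X Z \<longleftrightarrow>
    (\<exists>C\<^sub>0\<ge>1. \<forall>(A :: 'a set) (f :: 'a \<Rightarrow> 'b). \<forall>\<epsilon>>0. lipschitz_map_on A f \<longrightarrow>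
      (\<exists>g :: 'a \<Rightarrow> 'b. C1_smooth g \<and> lipschitz_map_on UNIV g \<and>
        (\<forall>x\<in>A. norm (f x - g x) < \<epsilon>) \<and> Lip UNIV g \<le> C\<^sub>0 * Lip A f))"

definition mean_value_condition ::
    "'a::real_normed_vector set \<Rightarrow> ('a \<Rightarrow> 'b::real_normed_vector) \<Rightarrow> bool"
  where "mean_value_condition A f \<longleftrightarrow>
    (\<exists>D :: 'a \<Rightarrow> 'a \<Rightarrow>\<^sub>L 'b. continuous_on A D \<and>
      (\<forall>y\<in>A. \<forall>\<epsilon>>0. \<exists>r>0. \<forall>z \<in> A \<inter> ball y r. \<forall>w \<in> A \<inter> ball y r.
        norm (f z - f w - blinfun_apply (D y) (z - w)) \<le> \<epsilon> * norm (z - w)))"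

end

theory Submission
  imports Defs
begin

text \<open>
  If \<open>f\<close> extends to a \<open>C\<^sup>1\<close> map \<open>G\<close>, then the derivative of \<open>G\<close> is a witness of the mean value condition,
  by the mean value inequality on small balls. The converse is proved by successive approximation.

  Near a point \<open>y\<close> of \<open>A\<close>, the condition says that \<open>f - D y\<close> has a small Lipschitz constant on \<open>A\<close>. Property (*)
  replaces this difference by a \<open>C\<^sup>1\<close> map with small Lipschitz constant, so locally \<open>f\<close> has \<open>C\<^sup>1\<close>
  approximations that are arbitrarily close to \<open>f\<close>, whose derivatives are close to \<open>D\<close> on \<open>A\<close>, and whose
  error has a small Lipschitz constant on \<open>A\<close>. Such approximations can be glued
  (\<open>approximable_UNIV_if_locally\<close>). The space need not be separable, and the cover is made countable by
  Stone's argument: at each scale the pieces form a uniformly separated family, and a separated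
  family behaves like a single piece. The pieces of the countable cover are glued with
  a \<open>C\<^sup>1\<close> Lipschitz partition of unity. Its members also come from property (*), applied to distance
  functions times a vector \<open>e\<close> of \<open>Z\<close> and followed by a functional that does not vanish at \<open>e\<close>
  (\<open>exists_cutoff\<close>). The local approximations are selected after the partition of unity, so their uniform
  error can absorb its Lipschitz constants.

  The result is a \<open>C\<^sup>1\<close> map that is close to \<open>f\<close> to first order on \<open>A\<close>. To sum a series of such
  corrections, their derivatives must be small on the whole space when \<open>f\<close> has a small Lipschitz
  constant and \<open>D\<close> is small on \<open>A\<close>. For this, property (*) is used once more to extend Lipschitz maps from subsets with a
  controlled constant (\<open>lipschitz_extension\<close>); the extension interpolates, as the distance to the subset
  decreases, between finer and finer smooth approximations. Extending the
  approximation from a thin neighbourhood of \<open>A\<close> and gluing again gives a correction with small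
  derivative everywhere (\<open>controlled_C1_approximation\<close>), and a geometric series of corrections sums to the desired
  extension (\<open>C1_extension\<close>).
\<close>

section \<open>Continuously differentiable maps on open sets\<close>

definition C1_on :: "'a::real_normed_vector set \<Rightarrow> ('a \<Rightarrow> 'b::real_normed_vector) \<Rightarrow> ('a \<Rightarrow> 'a \<Rightarrow>\<^sub>L 'b) \<Rightarrow> bool"
  where "C1_on U u u' \<longleftrightarrow>
    (\<forall>x\<in>U. (u has_derivative blinfun_apply (u' x)) (at x)) \<and> continuous_on U u'"

lemma C1_smooth_iff_C1_on: "C1_smooth g \<longleftrightarrow> (\<exists>g'. C1_on UNIV g g')"
  by (simp add: C1_smooth_def C1_on_def)

lemma C1_onD:
  assumes "C1_on U u u'"
  shows "x \<in> U \<Longrightarrow> (u has_derivative blinfun_apply (u' x)) (at x)"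
    and "continuous_on U u'"
  using assms by (auto simp: C1_on_def)

lemma C1_on_subset: "C1_on U u u' \<Longrightarrow> V \<subseteq> U \<Longrightarrow> C1_on V u u'"
  unfolding C1_on_def by (meson continuous_on_subset subsetD)

lemma C1_on_imp_continuous_on: "C1_on U u u' \<Longrightarrow> continuous_on U u"
  unfolding C1_on_def by (meson continuous_at_imp_continuous_on has_derivative_continuous)

lemma C1_on_const: "C1_on U (\<lambda>_. c) (\<lambda>_. 0)"
  unfolding C1_on_def by (simp add: zero_blinfun.rep_eq)

lemma C1_on_blinfun_apply: "C1_on U (blinfun_apply T) (\<lambda>_. T)"
  unfolding C1_on_def by (auto intro: bounded_linear_imp_has_derivative blinfun.bounded_linear_right)

lemma C1_on_add:
  assumes "C1_on U u u'" "C1_on U v v'"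
  shows "C1_on U (\<lambda>x. u x + v x) (\<lambda>x. u' x + v' x)"
  using assms unfolding C1_on_def
  by (auto simp: blinfun.add_left[abs_def] plus_blinfun.rep_eq intro!: has_derivative_add continuous_on_add)

lemma C1_on_diff:
  assumes "C1_on U u u'" "C1_on U v v'"
  shows "C1_on U (\<lambda>x. u x - v x) (\<lambda>x. u' x - v' x)"
  using assms unfolding C1_on_def
  by (auto simp: minus_blinfun.rep_eq intro!: has_derivative_diff continuous_on_diff)

lemma C1_on_sum:
  assumes "\<And>i. i \<in> I \<Longrightarrow> C1_on U (u i) (u' i)"
  shows "C1_on U (\<lambda>x. \<Sum>i\<in>I. u i x) (\<lambda>x. \<Sum>i\<in>I. u' i x)"
  using assms
  by (induction I rule: infinite_finite_induct) (auto simp: C1_on_const intro!: C1_on_add)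

lemma C1_on_scaleR:
  assumes "C1_on U \<phi> \<phi>'" "C1_on U u u'"
  shows "C1_on U (\<lambda>x. \<phi> x *\<^sub>R u x) (\<lambda>x. \<phi> x *\<^sub>R u' x + (blinfun_scaleR_left (u x) o\<^sub>L \<phi>' x))"
proof -
  have "((\<lambda>x. \<phi> x *\<^sub>R u x) has_derivative
      blinfun_apply (\<phi> x *\<^sub>R u' x + (blinfun_scaleR_left (u x) o\<^sub>L \<phi>' x))) (at x)" if "x \<in> U" for x
    by (rule has_derivative_eq_rhs[OF has_derivative_scaleR[OF C1_onD(1)[OF assms(1) that] C1_onD(1)[OF assms(2) that]]])
       (auto simp: fun_eq_iff plus_blinfun.rep_eq scaleR_blinfun.rep_eq)
  moreover have "continuous_on U (\<lambda>x. \<phi> x *\<^sub>R u' x + (blinfun_scaleR_left (u x) o\<^sub>L \<phi>' x))"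
    using C1_on_imp_continuous_on[OF assms(1)] C1_on_imp_continuous_on[OF assms(2)] assms
    by (intro continuous_intros bounded_linear.continuous_on[OF bounded_linear_blinfun_scaleR_left])
       (auto simp: C1_on_def)
  ultimately show ?thesis by (simp add: C1_on_def)
qed

lemma C1_on_compose_real:
  fixes \<theta> :: "real \<Rightarrow> real"
  assumes u: "C1_on U u u'" and \<theta>: "\<And>t. (\<theta> has_real_derivative \<theta>' t) (at t)" "continuous_on UNIV \<theta>'"
  shows "C1_on U (\<lambda>x. \<theta> (u x)) (\<lambda>x. \<theta>' (u x) *\<^sub>R u' x)"
proof -
  have "((\<lambda>x. \<theta> (u x)) has_derivative blinfun_apply (\<theta>' (u x) *\<^sub>R u' x)) (at x)" if "x \<in> U" for x
    using has_derivative_compose[OF C1_onD(1)[OF u that] \<theta>(1)[of "u x", unfolded has_field_derivative_def]]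
    by (simp add: scaleR_blinfun.rep_eq)
  moreover have "continuous_on U (\<lambda>x. \<theta>' (u x) *\<^sub>R u' x)"
    using u C1_on_imp_continuous_on[OF u]
    by (intro continuous_intros continuous_on_compose2[OF \<theta>(2)]) (auto simp: C1_on_def)
  ultimately show ?thesis by (simp add: C1_on_def)
qed

lemma C1_on_blinfun_compose:
  assumes "C1_on U u u'"
  shows "C1_on U (\<lambda>x. blinfun_apply T (u x)) (\<lambda>x. T o\<^sub>L u' x)"
proof -
  have "((\<lambda>x. blinfun_apply T (u x)) has_derivative blinfun_apply (T o\<^sub>L u' x)) (at x)" if "x \<in> U" for x
    by (rule has_derivative_eq_rhs[OF bounded_linear.has_derivative[OF blinfun.bounded_linear_right C1_onD(1)[OF assms that]]])
       auto
  moreover have "continuous_on U (\<lambda>x. T o\<^sub>L u' x)"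
    using assms by (intro continuous_intros) (auto simp: C1_on_def)
  ultimately show ?thesis by (simp add: C1_on_def)
qed

text \<open>
  The derivative is prescribed together with the function, so being \<open>C\<^sup>1\<close> is a local
  property of the pair; this is how functions defined by gluing are recognised below.
\<close>
lemma C1_on_locally:
  assumes "\<And>x. x \<in> U \<Longrightarrow> \<exists>V v v'. open V \<and> x \<in> V \<and> C1_on V v v' \<and> (\<forall>y\<in>V. u y = v y \<and> u' y = v' y)"
  shows "C1_on U u u'"
proof -
  have "(u has_derivative blinfun_apply (u' x)) (at x) \<and> isCont u' x" if xU: "x \<in> U" for x
  proof -
    obtain V v v' where V: "open V" "x \<in> V" "C1_on V v v'" "\<forall>y\<in>V. u y = v y \<and> u' y = v' y"
      using assms[OF xU] by blast
    have "(u has_derivative blinfun_apply (v' x)) (at x)"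
      by (rule has_derivative_transform_within_open[OF C1_onD(1)[OF V(3,2)] V(1,2)]) (use V(4) in auto)
    moreover have "isCont v' x"
      using V(1,2,3) by (simp add: C1_on_def continuous_on_eq_continuous_at)
    moreover have "\<forall>\<^sub>F y in nhds x. u' y = v' y"
      using V(1,2,4) eventually_nhds by blast
    ultimately have "(u has_derivative blinfun_apply (v' x)) (at x)" "isCont u' x"
      using isCont_cong by blast+
    then show ?thesis using V(2,4) by simp
  qed
  then show ?thesis by (simp add: C1_on_def continuous_at_imp_continuous_on)
qed

lemma norm_derivative_le_lipschitz:
  fixes T :: "'a::real_normed_vector \<Rightarrow>\<^sub>L 'b::real_normed_vector"
  assumes lip: "L-lipschitz_on U g" and U: "open U" "x \<in> U"
    and der: "(g has_derivative blinfun_apply T) (at x)"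
  shows "norm T \<le> L"
proof (rule norm_blinfun_bound)
  show "0 \<le> L" using lip by (rule lipschitz_on_nonneg)
  fix h :: 'a
  show "norm (blinfun_apply T h) \<le> L * norm h"
  proof (cases "h = 0")
    case False
    have "norm (blinfun_apply T h) / norm h \<le> L + e" if "e > 0" for e
    proof -
      obtain d where d: "d > 0"
        "\<And>y. norm (y - x) < d \<Longrightarrow> norm (g y - g x - blinfun_apply T (y - x)) \<le> e * norm (y - x)"
        using der \<open>e > 0\<close> unfolding has_derivative_at_alt by blast
      obtain r where r: "r > 0" "ball x r \<subseteq> U" using U open_contains_ball by blast
      define t where "t = min d r / 2 / norm h"
      define y where "y = x + t *\<^sub>R h"
      have t: "t > 0" using d r False by (simp add: t_def)
      have ny: "norm (y - x) = min d r / 2" using d(1) r(1) False by (simp add: y_def t_def)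
      have "y \<in> U" using r d(1) ny by (auto simp: dist_norm norm_minus_commute)
      then have 1: "norm (g y - g x) \<le> L * norm (y - x)"
        using lipschitz_on_normD[OF lip] U by blast
      have 2: "norm (g y - g x - blinfun_apply T (y - x)) \<le> e * norm (y - x)"
        using d ny r(1) by auto
      have "norm (blinfun_apply T (y - x)) \<le> (L + e) * norm (y - x)"
        using norm_triangle_sub[of "blinfun_apply T (y - x)" "g y - g x"] 1 2
        by (simp add: algebra_simps norm_minus_commute)
      then show ?thesis using t False by (simp add: y_def blinfun.scaleR_right divide_simps)
    qed
    then have "norm (blinfun_apply T h) / norm h \<le> L" by (rule field_le_epsilon)
    then show ?thesis using False by (simp add: divide_simps)
  qed simp
qed

lemma lipschitz_on_convex_of_derivative:
  assumes "C1_on U u u'" "convex U" "\<And>x. x \<in> U \<Longrightarrow> norm (u' x) \<le> B" "0 \<le> B"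
  shows "B-lipschitz_on U u"
proof (rule lipschitz_onI)
  fix x y assume "x \<in> U" "y \<in> U"
  then show "dist (u x) (u y) \<le> B * dist x y"
    using differentiable_bound[OF assms(2), of u "\<lambda>x. blinfun_apply (u' x)" B x y] assms
    by (auto simp: dist_norm norm_blinfun.rep_eq C1_on_def intro: has_derivative_at_withinI)
qed (use assms in auto)

section \<open>A nonzero bounded functional\<close>

text \<open>
  Cutoff functions are real valued while the smoothing hypothesis produces maps into \<open>Z\<close>;
  a bounded functional that does not vanish at a given vector of \<open>Z\<close> turns the latter into the former.
  Such a functional is a minimal element, for the pointwise order, of a suitable set of sublinear
  functions dominated by the norm.
\<close>
definition sublinear :: "('a::real_normed_vector \<Rightarrow> real) \<Rightarrow> bool"
  where "sublinear p \<longleftrightarrow> (\<forall>x y. p (x + y) \<le> p x + p y) \<and>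
    (\<forall>c\<ge>0. \<forall>x. p (c *\<^sub>R x) = c * p x) \<and> (\<forall>x. p x \<le> norm x)"

lemma sublinearD:
  assumes "sublinear p"
  shows "p (x + y) \<le> p x + p y" "c \<ge> 0 \<Longrightarrow> p (c *\<^sub>R x) = c * p x" "p x \<le> norm x"
    "p 0 = 0" "- p (- x) \<le> p x" "- norm x \<le> p x"
proof -
  show A: "p (x + y) \<le> p x + p y" "p x \<le> norm x" "c \<ge> 0 \<Longrightarrow> p (c *\<^sub>R x) = c * p x" for x y c
    using assms by (auto simp: sublinear_def)
  show Z: "p 0 = 0" using A(3)[of 0 0] by simp
  show "- p (- x) \<le> p x" using A(1)[of x "-x"] Z by simp
  then show "- norm x \<le> p x" using A(2)[of "-x"] by simp
qed


text \<open>
  The standard way of lowering a sublinear function: among the sublinear functions below \<open>p\<close>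
  this one takes at \<open>-a\<close> the least conceivable value, \<open>- p a\<close>.
\<close>
definition ray_infimum :: "('a::real_normed_vector \<Rightarrow> real) \<Rightarrow> 'a \<Rightarrow> 'a \<Rightarrow> real"
  where "ray_infimum p a x = (INF t\<in>{0..}. p (x + t *\<^sub>R a) - t * p a)"

lemma ray_infimum:
  assumes p: "sublinear p"
  shows "sublinear (ray_infimum p a)" "ray_infimum p a x \<le> p x" "ray_infimum p a (- a) \<le> - p a"
proof -
  let ?q = "ray_infimum p a"
  note pD = sublinearD[OF p]
  have low: "- p (- x) \<le> p (x + t *\<^sub>R a) - t * p a" if "t \<ge> 0" for t x
    using pD(1)[of "x + t *\<^sub>R a" "- x"] pD(2)[OF that, of a] by simp
  have bdd: "bdd_below ((\<lambda>t. p (x + t *\<^sub>R a) - t * p a) ` {0..})" for x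
    using low by (intro bdd_belowI[of _ "- p (- x)"]) auto
  have le: "?q x \<le> p (x + t *\<^sub>R a) - t * p a" if "t \<ge> 0" for t x
    unfolding ray_infimum_def by (rule cINF_lower[OF bdd]) (use that in auto)
  have ge: "m \<le> ?q x" if "\<And>t. t \<ge> 0 \<Longrightarrow> m \<le> p (x + t *\<^sub>R a) - t * p a" for m x
    unfolding ray_infimum_def by (rule cINF_greatest) (use that in auto)
  show le0: "?q x \<le> p x" for x using le[of 0 x] by simp
  show "?q (- a) \<le> - p a" using le[of 1 "- a"] pD(4) by simp
  have add: "?q (x + y) \<le> ?q x + ?q y" for x y
  proof -
    have "?q (x + y) - (p (x + s *\<^sub>R a) - s * p a) \<le> ?q y" if "s \<ge> 0" for s
    proof (rule ge)
      fix t :: real assume "t \<ge> 0"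
      have "?q (x + y) \<le> p ((x + s *\<^sub>R a) + (y + t *\<^sub>R a)) - (s + t) * p a"
        using le[of "s + t" "x + y"] \<open>s \<ge> 0\<close> \<open>t \<ge> 0\<close> by (simp add: algebra_simps)
      also have "\<dots> \<le> p (x + s *\<^sub>R a) + p (y + t *\<^sub>R a) - (s + t) * p a"
        using pD(1) by simp
      finally show "?q (x + y) - (p (x + s *\<^sub>R a) - s * p a) \<le> p (y + t *\<^sub>R a) - t * p a"
        by (simp add: algebra_simps)
    qed
    then have "?q (x + y) - ?q y \<le> ?q x" by (intro ge) (simp add: algebra_simps)
    then show ?thesis by simp
  qed
  have hom1: "c * ?q x \<le> ?q (c *\<^sub>R x)" if "c > 0" for c x
  proof (rule ge)
    fix t :: real assume "t \<ge> 0"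
    have "c * ?q x \<le> c * (p (x + (t / c) *\<^sub>R a) - (t / c) * p a)"
      using le[of "t / c" x] \<open>t \<ge> 0\<close> \<open>c > 0\<close> by (intro mult_left_mono) auto
    also have "\<dots> = p (c *\<^sub>R (x + (t / c) *\<^sub>R a)) - t * p a"
      using \<open>c > 0\<close> by (subst pD(2)) (auto simp: algebra_simps)
    also have "c *\<^sub>R (x + (t / c) *\<^sub>R a) = c *\<^sub>R x + t *\<^sub>R a"
      using \<open>c > 0\<close> by (simp add: algebra_simps)
    finally show "c * ?q x \<le> p (c *\<^sub>R x + t *\<^sub>R a) - t * p a" .
  qed
  have hom: "?q (c *\<^sub>R x) = c * ?q x" if "c \<ge> 0" for c x
  proof (cases "c = 0")
    case True
    have "0 \<le> ?q 0" by (rule ge) (use low[of _ 0] pD(4) in simp)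
    then have "?q 0 = 0" using le0[of 0] pD(4) by simp
    then show ?thesis using True by simp
  next
    case False
    then have c: "c > 0" using that by simp
    have "(1 / c) * ?q (c *\<^sub>R x) \<le> ?q x" using hom1[of "1 / c" "c *\<^sub>R x"] c by simp
    then have "?q (c *\<^sub>R x) \<le> c * ?q x" using c by (simp add: field_simps)
    then show ?thesis using hom1[OF c, of x] by simp
  qed
  show "sublinear ?q"
    using add hom le0 pD(3) order_trans unfolding sublinear_def by blast
qed

text \<open>
  By minimality \<open>q\<close> agrees with each \<open>ray_infimum q a\<close>, so \<open>q (- a) \<le> - q a\<close>. Hence \<open>q\<close> is odd,
  and an odd subadditive function is additive.
\<close>
lemma minimal_sublinear_linear:
  fixes q :: "'a::real_normed_vector \<Rightarrow> real"
  assumes q: "sublinear q" and min: "\<And>p. sublinear p \<Longrightarrow> (\<And>x. p x \<le> q x) \<Longrightarrow> p = q"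
  shows "bounded_linear q"
proof -
  have neg: "q (- a) = - q a" for a
    using min[OF ray_infimum(1,2)[OF q], of a] ray_infimum(3)[OF q, of a] sublinearD(5)[OF q, of "-a"]
    by simp
  have add: "q (x + y) = q x + q y" for x y
    using sublinearD(1)[OF q, of x y] sublinearD(1)[OF q, of "-x" "-y"] neg[of x] neg[of y] neg[of "x + y"]
    by simp
  show ?thesis
  proof (rule bounded_linear_intro[where K = 1])
    fix c x
    show "q (c *\<^sub>R x) = c *\<^sub>R q x"
      using sublinearD(2)[OF q, of c x] sublinearD(2)[OF q, of "- c" x] neg[of "c *\<^sub>R x"]
      by (cases "c \<ge> 0") auto
    show "norm (q x) \<le> norm x * 1"
      using sublinearD(3,6)[OF q, of x] by (simp add: abs_le_iff)
  qed (rule add)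
qed

text \<open>
  Zorn's lemma is applied to the sublinear functions with \<open>p (- e) \<le> - norm e\<close>. This condition
  passes to smaller functions, so a minimal element of the set is minimal among all sublinear
  functions and therefore linear; its value at \<open>e\<close> is then at least \<open>norm e\<close>. The set is nonempty
  because lowering the norm along \<open>e\<close> achieves exactly this condition.
\<close>
lemma norming_functional:
  fixes e :: "'a::real_normed_vector"
  obtains T :: "'a \<Rightarrow>\<^sub>L real" where "norm e \<le> blinfun_apply T e"
proof -
  define A where "A = {p :: 'a \<Rightarrow> real. sublinear p \<and> p (- e) \<le> - norm e}"
  define R where "R = (\<lambda>p q :: 'a \<Rightarrow> real. \<forall>x. q x \<le> p x)"
  have ne: "ray_infimum norm e \<in> A"
    using ray_infimum[of norm e] by (auto simp: A_def sublinear_def norm_triangle_ineq)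
  have "\<exists>m\<in>A. \<forall>a\<in>A. R m a \<longrightarrow> a = m"
  proof (rule predicate_Zorn)
    show "partial_order_on A (relation_of R A)"
      by (rule partial_order_on_relation_ofI) (auto simp: R_def fun_eq_iff intro: order_trans antisym)
  next
    fix C assume C: "C \<in> Chains (relation_of R A)"
    show "\<exists>u\<in>A. \<forall>a\<in>C. R a u"
    proof (cases "C = {}")
      case True
      then show ?thesis using ne by blast
    next
      case False
      have CA: "sublinear p" "p (- e) \<le> - norm e" if "p \<in> C" for p
        using C that by (auto simp: Chains_def relation_of_def A_def)
      have chain: "R p q \<or> R q p" if "p \<in> C" "q \<in> C" for p q
        using C that by (auto simp: Chains_def relation_of_def)
      define u where "u = (\<lambda>x. INF p\<in>C. p x)"
      have bdd: "bdd_below ((\<lambda>p. p x) ` C)" for x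
        using sublinearD(6)[OF CA(1)] by (intro bdd_belowI[of _ "- norm x"]) auto
      have le: "u x \<le> p x" if "p \<in> C" for p x
        unfolding u_def by (rule cINF_lower[OF bdd that])
      have ge: "m \<le> u x" if "\<And>p. p \<in> C \<Longrightarrow> m \<le> p x" for m x
        unfolding u_def by (rule cINF_greatest[OF False that])
      \<comment> \<open>In a chain, two members are dominated by the smaller of them.\<close>
      have add: "u (x + y) \<le> u x + u y" for x y
      proof -
        have key: "u (x + y) \<le> p x + q y" if pq: "p \<in> C" "q \<in> C" for p q
        proof -
          obtain r where r: "r \<in> C" "r x \<le> p x" "r y \<le> q y"
            using chain[OF pq] pq by (auto simp: R_def)
          show ?thesis
            using le[OF r(1), of "x + y"] sublinearD(1)[OF CA(1)[OF r(1)], of x y] r by linarith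
        qed
        have "u (x + y) - p x \<le> u y" if "p \<in> C" for p
        proof (rule ge)
          fix q assume "q \<in> C"
          then show "u (x + y) - p x \<le> q y" using key[OF that, of q] by (simp only: diff_le_eq add.commute)
        qed
        then have "u (x + y) - u y \<le> u x" by (intro ge) (simp add: algebra_simps)
        then show ?thesis by simp
      qed
      have hom: "u (c *\<^sub>R x) = c * u x" if "c \<ge> 0" for c x
      proof (cases "c = 0")
        case True
        have "u 0 = (INF p\<in>C. 0)"
          unfolding u_def by (rule INF_cong) (use sublinearD(4)[OF CA(1)] in auto)
        then have "u 0 = 0" using False by simp
        then show ?thesis using True by simp
      next
        case cF: False
        have ge': "c * u x \<le> u (c *\<^sub>R x)" if c: "c > 0" for c x
        proof (rule ge)
          fix p assume "p \<in> C"
          then have "c * u x \<le> c * p x" using le c by (intro mult_left_mono) auto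
          then show "c * u x \<le> p (c *\<^sub>R x)" using sublinearD(2)[OF CA(1)] \<open>p \<in> C\<close> c by simp
        qed
        have "(1 / c) * u (c *\<^sub>R x) \<le> u x" using ge'[of "1 / c" "c *\<^sub>R x"] cF \<open>c \<ge> 0\<close> by simp
        then have "u (c *\<^sub>R x) \<le> c * u x" using cF \<open>c \<ge> 0\<close> by (simp add: field_simps)
        then show ?thesis using ge'[of c x] cF \<open>c \<ge> 0\<close> by simp
      qed
      have "sublinear u"
        unfolding sublinear_def using add hom le sublinearD(3)[OF CA(1)] False
        by (meson ex_in_conv order_trans)
      moreover have "u (- e) \<le> - norm e"
        using le CA(2) False by (meson ex_in_conv order_trans)
      ultimately show ?thesis using le by (auto simp: A_def R_def)
    qed
  qed
  then obtain q where q: "q \<in> A" "\<And>p. p \<in> A \<Longrightarrow> R q p \<Longrightarrow> p = q" by blast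
  have lin: "bounded_linear q"
  proof (rule minimal_sublinear_linear)
    show "sublinear q" using q(1) by (simp add: A_def)
    fix p assume p: "sublinear p" "\<And>x. p x \<le> q x"
    have "p (- e) \<le> - norm e" using p(2)[of "- e"] q(1) by (simp add: A_def)
    then show "p = q" using q(2) p by (simp add: A_def R_def)
  qed
  have "norm e \<le> q e"
    using q(1) linear_neg[OF bounded_linear.linear[OF lin], of e] by (simp add: A_def)
  then show ?thesis
    using that[of "Blinfun q"] bounded_linear_Blinfun_apply[OF lin] by simp
qed

section \<open>Lipschitz smoothing and cutoff functions\<close>

text \<open>
  Property (*) with its constant exposed, and phrased for an arbitrary Lipschitz bound \<open>L\<close>
  instead of the least one, so that estimates of Lipschitz constants can be used directly.
\<close>
definition lipschitz_smoothing :: "real \<Rightarrow> 'a::banach itself \<Rightarrow> 'b::banach itself \<Rightarrow> bool"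
  where "lipschitz_smoothing C X Z \<longleftrightarrow> C \<ge> 1 \<and>
    (\<forall>(A :: 'a set) (f :: 'a \<Rightarrow> 'b) L \<epsilon>. L-lipschitz_on A f \<longrightarrow> \<epsilon> > 0 \<longrightarrow>
      (\<exists>g g'. C1_on UNIV g g' \<and> (C * L)-lipschitz_on UNIV g \<and> (\<forall>x\<in>A. norm (g x - f x) \<le> \<epsilon>)))"

lemma lipschitz_smoothingE:
  fixes A :: "'a::banach set" and f :: "'a \<Rightarrow> 'b::banach"
  assumes "lipschitz_smoothing C TYPE('a) TYPE('b)" "L-lipschitz_on A f" "\<epsilon> > 0"
  obtains g g' where "C1_on UNIV g g'" "(C * L)-lipschitz_on UNIV g"
    "\<And>x. x \<in> A \<Longrightarrow> norm (g x - f x) \<le> \<epsilon>"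
  using assms unfolding lipschitz_smoothing_def by blast

lemma Lip_le:
  assumes "L-lipschitz_on A f"
  shows "Lip A f \<le> L"
  unfolding Lip_def
proof (rule cSup_least)
  fix q assume "q \<in> insert 0 {norm (f x - f y) / norm (x - y) |x y. x \<in> A \<and> y \<in> A \<and> x \<noteq> y}"
  then show "q \<le> L"
    using lipschitz_on_normD[OF assms] lipschitz_on_nonneg[OF assms] by (auto simp: pos_divide_le_eq)
qed simp

lemma lipschitz_on_Lip:
  assumes "lipschitz_map_on A f"
  shows "(Lip A f)-lipschitz_on A f"
proof -
  let ?Q = "insert 0 {norm (f x - f y) / norm (x - y) |x y. x \<in> A \<and> y \<in> A \<and> x \<noteq> y}"
  obtain L where L: "L-lipschitz_on A f" using assms by (auto simp: lipschitz_map_on_def)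
  have bdd: "bdd_above ?Q"
    using lipschitz_on_normD[OF L] lipschitz_on_nonneg[OF L]
    by (intro bdd_aboveI[of _ L]) (auto simp: pos_divide_le_eq)
  have q: "q \<le> Lip A f" if "q \<in> ?Q" for q
    unfolding Lip_def by (rule cSup_upper[OF that bdd])
  show ?thesis
  proof (rule lipschitz_onI)
    show "0 \<le> Lip A f" by (rule q) simp
    fix x y assume "x \<in> A" "y \<in> A"
    then show "dist (f x) (f y) \<le> Lip A f * dist x y"
    proof (cases "x = y")
      case False
      then have "norm (f x - f y) / norm (x - y) \<le> Lip A f"
        using \<open>x \<in> A\<close> \<open>y \<in> A\<close> by (intro q) blast
      then show ?thesis using False by (simp add: dist_norm pos_divide_le_eq)
    qed simp
  qed
qed

lemma property_star_imp_lipschitz_smoothing: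
  assumes "property_star TYPE('a::banach) TYPE('b::banach)"
  obtains C where "lipschitz_smoothing C TYPE('a) TYPE('b)"
proof -
  obtain C where C: "C \<ge> 1" "\<And>(A :: 'a set) (f :: 'a \<Rightarrow> 'b) \<epsilon>. \<epsilon> > 0 \<Longrightarrow> lipschitz_map_on A f \<Longrightarrow>
      \<exists>g. C1_smooth g \<and> lipschitz_map_on UNIV g \<and> (\<forall>x\<in>A. norm (f x - g x) < \<epsilon>) \<and>
        Lip UNIV g \<le> C * Lip A f"
    using assms unfolding property_star_def by metis
  have "\<exists>g g'. C1_on UNIV g g' \<and> (C * L)-lipschitz_on UNIV g \<and> (\<forall>x\<in>A. norm (g x - f x) \<le> \<epsilon>)"
    if L: "L-lipschitz_on A f" and "\<epsilon> > 0" for A :: "'a set" and f :: "'a \<Rightarrow> 'b" and L \<epsilon>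
  proof -
    obtain g where g: "C1_smooth g" "lipschitz_map_on UNIV g" "\<forall>x\<in>A. norm (f x - g x) < \<epsilon>"
        "Lip UNIV g \<le> C * Lip A f"
      using C(2)[OF \<open>\<epsilon> > 0\<close>, of A f] L by (auto simp: lipschitz_map_on_def)
    have "Lip UNIV g \<le> C * L" using g(4) Lip_le[OF L] C(1) mult_left_mono[of "Lip A f" L C] by linarith
    then have "(C * L)-lipschitz_on UNIV g" using lipschitz_on_Lip[OF g(2)] lipschitz_on_mono by blast
    moreover obtain g' where "C1_on UNIV g g'" using g(1) by (auto simp: C1_smooth_iff_C1_on)
    ultimately show ?thesis using g(3) by (metis less_imp_le norm_minus_commute)
  qed
  with C(1) show thesis by (intro that[of C]) (simp add: lipschitz_smoothing_def)
qed

text \<open>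
  The derivative \<open>\<theta>'\<close> is the piecewise linear hat supported by \<open>[0, 1]\<close> with height \<open>2\<close>, so its
  integral is \<open>1\<close>. The function \<open>p\<close> of the proof is the square of the positive part.
\<close>
lemma C1_ramp:
  obtains \<theta> \<theta>' :: "real \<Rightarrow> real"
  where "\<And>t. (\<theta> has_real_derivative \<theta>' t) (at t)" "continuous_on UNIV \<theta>'" "2-lipschitz_on UNIV \<theta>"
    "\<And>t. 0 \<le> \<theta> t" "\<And>t. \<theta> t \<le> 1" "\<And>t. t \<le> 0 \<Longrightarrow> \<theta> t = 0" "\<And>t. t \<ge> 1 \<Longrightarrow> \<theta> t = 1"
proof -
  have sq: "((\<lambda>t :: real. t * \<bar>t\<bar>) has_real_derivative 2 * \<bar>t\<bar>) (at t)" for t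
  proof (cases "t = 0")
    case True
    have "((\<lambda>h :: real. h * \<bar>h\<bar> / h) \<longlongrightarrow> 0) (at 0)"
      by (rule tendsto_eq_rhs[OF Lim_transform_eventually[of "\<lambda>h. \<bar>h\<bar>"]])
         (auto simp: eventually_at_filter intro!: tendsto_eq_intros)
    then show ?thesis using True by (simp add: DERIV_def)
  next
    case False
    show ?thesis
    proof (cases "t > 0")
      case True
      have "((\<lambda>t :: real. t * t) has_real_derivative 2 * \<bar>t\<bar>) (at t)"
        using True by (auto intro!: derivative_eq_intros)
      then show ?thesis
        by (rule has_field_derivative_transform_within_open[where S = "{0<..}"]) (use True in auto)
    next
      case F: False
      have "((\<lambda>t :: real. - (t * t)) has_real_derivative 2 * \<bar>t\<bar>) (at t)"
        using F by (auto intro!: derivative_eq_intros)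
      then show ?thesis
        by (rule has_field_derivative_transform_within_open[where S = "{..<0}"]) (use False F in auto)
    qed
  qed
  define p where "p = (\<lambda>t :: real. (t * t + t * \<bar>t\<bar>) / 2)"
  define p' where "p' = (\<lambda>t :: real. t + \<bar>t\<bar>)"
  have p: "(p has_real_derivative p' t) (at t)" for t
    unfolding p_def p'_def
    by (rule DERIV_cong[OF DERIV_cdivide[OF DERIV_add[OF DERIV_mult[OF DERIV_ident DERIV_ident] sq]]]) simp
  have pc: "((\<lambda>t. p (t - c)) has_real_derivative p' (t - c)) (at t)" for c t
    by (rule DERIV_cong[OF DERIV_chain2[where f = p and g = "\<lambda>t. t - c", OF p DERIV_diff[OF DERIV_ident DERIV_const]]]) simp
  define \<theta> where "\<theta> = (\<lambda>t. 2 * p t - 4 * p (t - 1/2) + 2 * p (t - 1))"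
  define \<theta>' where "\<theta>' = (\<lambda>t. 2 * p' t - 4 * p' (t - 1/2) + 2 * p' (t - 1))"
  have d: "(\<theta> has_real_derivative \<theta>' t) (at t)" for t
    unfolding \<theta>_def \<theta>'_def by (rule derivative_eq_intros p pc refl)+ simp
  have c: "continuous_on UNIV \<theta>'"
    unfolding \<theta>'_def p'_def by (intro continuous_intros)
  have b: "0 \<le> \<theta>' t" "\<theta>' t \<le> 2" for t
    unfolding \<theta>'_def p'_def by (auto simp: abs_if)
  have lip: "2-lipschitz_on UNIV \<theta>"
  proof (rule lipschitz_onI)
    fix x y :: real
    show "dist (\<theta> x) (\<theta> y) \<le> 2 * dist x y"
      using field_differentiable_bound[of UNIV \<theta> \<theta>' 2 x y] d b by (auto simp: dist_norm)
  qed simp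
  have mono: "\<theta> s \<le> \<theta> t" if "s \<le> t" for s t
    using DERIV_nonneg_imp_nondecreasing[OF that, of \<theta>] d b by blast
  have z: "\<theta> t = 0" if "t \<le> 0" for t using that by (simp add: \<theta>_def p_def algebra_simps)
  have o: "\<theta> t = 1" if "t \<ge> 1" for t using that by (simp add: \<theta>_def p_def field_simps)
  have "0 \<le> \<theta> t" for t using mono[of 0 t] z by (cases "t \<le> 0") auto
  moreover have "\<theta> t \<le> 1" for t using mono[of t 1] o by (cases "t \<ge> 1") auto
  ultimately show thesis using that d c lip z o by blast
qed

definition cutoff :: "('a::real_normed_vector \<Rightarrow> real) \<Rightarrow> bool"
  where "cutoff \<phi> \<longleftrightarrow> (\<exists>\<phi>'. C1_on UNIV \<phi> \<phi>') \<and> (\<exists>L. L-lipschitz_on UNIV \<phi>) \<and> (\<forall>x. 0 \<le> \<phi> x \<and> \<phi> x \<le> 1)"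

lemma cutoff_const: "0 \<le> c \<Longrightarrow> c \<le> 1 \<Longrightarrow> cutoff (\<lambda>_. c)"
  using C1_on_const lipschitz_on_constant unfolding cutoff_def by blast

lemma cutoff_complement:
  assumes "cutoff \<phi>"
  shows "cutoff (\<lambda>x. 1 - \<phi> x)"
proof -
  obtain \<phi>' L where "C1_on UNIV \<phi> \<phi>'" "L-lipschitz_on UNIV \<phi>" using assms by (auto simp: cutoff_def)
  then show ?thesis
    using C1_on_diff[OF C1_on_const] lipschitz_on_diff[OF lipschitz_on_constant] assms
    unfolding cutoff_def by fastforce
qed

lemma cutoff_mult:
  assumes "cutoff \<phi>" "cutoff \<psi>"
  shows "cutoff (\<lambda>x. \<phi> x * \<psi> x)"
proof -
  obtain \<phi>' L where \<phi>: "C1_on UNIV \<phi> \<phi>'" "L-lipschitz_on UNIV \<phi>" "\<And>x. 0 \<le> \<phi> x" "\<And>x. \<phi> x \<le> 1"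
    using assms(1) by (auto simp: cutoff_def)
  obtain \<psi>' M where \<psi>: "C1_on UNIV \<psi> \<psi>'" "M-lipschitz_on UNIV \<psi>" "\<And>x. 0 \<le> \<psi> x" "\<And>x. \<psi> x \<le> 1"
    using assms(2) by (auto simp: cutoff_def)
  have "(L + M)-lipschitz_on UNIV (\<lambda>x. \<phi> x * \<psi> x)"
  proof (rule lipschitz_onI)
    fix x y
    have "\<phi> x * \<psi> x - \<phi> y * \<psi> y = \<phi> x * (\<psi> x - \<psi> y) + (\<phi> x - \<phi> y) * \<psi> y"
      by (simp add: algebra_simps)
    also have "\<bar>\<dots>\<bar> \<le> \<phi> x * \<bar>\<psi> x - \<psi> y\<bar> + \<bar>\<phi> x - \<phi> y\<bar> * \<psi> y"
      using \<phi>(3)[of x] \<psi>(3)[of y] by (intro order_trans[OF abs_triangle_ineq]) (simp add: abs_mult)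
    also have "\<dots> \<le> 1 * (M * dist x y) + (L * dist x y) * 1"
      using lipschitz_onD[OF \<phi>(2), of x y] lipschitz_onD[OF \<psi>(2), of x y] \<phi>(3,4) \<psi>(3,4)
        lipschitz_on_nonneg[OF \<phi>(2)]
      by (intro add_mono mult_mono) (auto simp: dist_real_def)
    finally show "dist (\<phi> x * \<psi> x) (\<phi> y * \<psi> y) \<le> (L + M) * dist x y"
      by (simp add: dist_real_def algebra_simps)
  qed (use lipschitz_on_nonneg[OF \<phi>(2)] lipschitz_on_nonneg[OF \<psi>(2)] in auto)
  moreover have "\<exists>f'. C1_on UNIV (\<lambda>x. \<phi> x * \<psi> x) f'"
    using C1_on_scaleR[OF \<phi>(1) \<psi>(1)] by auto
  ultimately show ?thesis
    using \<phi>(3,4) \<psi>(3,4) unfolding cutoff_def by (auto intro: mult_le_one)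
qed

lemma cutoff_prod: "(\<And>i. i \<in> I \<Longrightarrow> cutoff (\<phi> i)) \<Longrightarrow> cutoff (\<lambda>x. \<Prod>i\<in>I. \<phi> i x)"
  by (induction I rule: infinite_finite_induct) (auto simp: cutoff_const intro: cutoff_mult)

text \<open>
  The function \<open>infdist x E *\<^sub>R e\<close> is Lipschitz with values in \<open>Z\<close>. Smoothing it and applying a
  functional with value \<open>1\<close> at \<open>e\<close> gives a \<open>C\<^sup>1\<close> function within \<open>s / 2\<close> of the distance to \<open>E\<close>,
  which a ramp turns into a cutoff. The scale \<open>3 * s\<close> leaves room for the two errors \<open>s / 2\<close> and
  for the width \<open>s\<close> of the ramp.
\<close>
lemma exists_cutoff:
  fixes E :: "'a::banach set" and e :: "'b::banach"
  assumes C: "lipschitz_smoothing C TYPE('a) TYPE('b)" and "e \<noteq> 0" "s > 0"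
  obtains \<phi> where "cutoff \<phi>" "\<And>x y. y \<in> E \<Longrightarrow> dist x y < s \<Longrightarrow> \<phi> x = 1"
    "\<And>x. (\<And>y. y \<in> E \<Longrightarrow> 3 * s \<le> dist x y) \<Longrightarrow> \<phi> x = 0"
proof (cases "E = {}")
  case True
  then show thesis using that[of "\<lambda>_. 0"] cutoff_const[of 0] by simp
next
  case False
  obtain T0 :: "'b \<Rightarrow>\<^sub>L real" where T0: "norm e \<le> blinfun_apply T0 e" by (rule norming_functional)
  define T where "T = (1 / blinfun_apply T0 e) *\<^sub>R T0"
  have Te: "blinfun_apply T e = 1"
    using T0 \<open>e \<noteq> 0\<close> by (auto simp: T_def scaleR_blinfun.rep_eq)
  define \<epsilon> where "\<epsilon> = s / 2 / (norm T + 1)"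
  have "\<epsilon> > 0" using \<open>s > 0\<close> by (simp add: \<epsilon>_def add_nonneg_pos)
  have "(norm e)-lipschitz_on UNIV (\<lambda>x. infdist x E *\<^sub>R e)"
    using infdist_triangle_abs[of _ E]
    by (intro lipschitz_onI)
       (auto simp: dist_norm mult.commute[of "norm e"] simp flip: scaleR_diff_left intro!: mult_right_mono)
  then obtain g g' where g: "C1_on UNIV g g'" "(C * norm e)-lipschitz_on UNIV g"
      "\<And>x. norm (g x - infdist x E *\<^sub>R e) \<le> \<epsilon>"
    using lipschitz_smoothingE[OF C _ \<open>\<epsilon> > 0\<close>] by (metis UNIV_I)
  define q where "q = (\<lambda>x. blinfun_apply T (g x))"
  obtain \<theta> \<theta>' :: "real \<Rightarrow> real" where
    \<theta>: "\<And>t. (\<theta> has_real_derivative \<theta>' t) (at t)" "continuous_on UNIV \<theta>'" "2-lipschitz_on UNIV \<theta>"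
      "\<And>t. 0 \<le> \<theta> t" "\<And>t. \<theta> t \<le> 1" "\<And>t. t \<le> 0 \<Longrightarrow> \<theta> t = 0" "\<And>t. t \<ge> 1 \<Longrightarrow> \<theta> t = 1"
    by (rule C1_ramp) blast
  have q: "\<bar>q x - infdist x E\<bar> \<le> s / 2" for x
  proof -
    have "q x - infdist x E = blinfun_apply T (g x - infdist x E *\<^sub>R e)"
      by (simp add: q_def blinfun.diff_right blinfun.scaleR_right Te)
    also have "\<bar>\<dots>\<bar> \<le> norm T * \<epsilon>"
      using norm_blinfun[of T "g x - infdist x E *\<^sub>R e"] mult_left_mono[OF g(3)[of x] norm_ge_zero[of T]]
      by simp
    also have "\<dots> \<le> s / 2"
      using \<open>s > 0\<close> by (simp add: \<epsilon>_def add_nonneg_pos divide_simps mult_right_mono)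
    finally show ?thesis .
  qed
  define \<phi> where "\<phi> = (\<lambda>x. \<theta> (5 / 2 - 1 / s * q x))"
  have "C1_on UNIV (\<lambda>x. 5 / 2 - 1 / s * q x) (\<lambda>x. 0 - ((1 / s) *\<^sub>R (T o\<^sub>L g' x) + (blinfun_scaleR_left (q x) o\<^sub>L 0)))"
    using C1_on_diff[OF C1_on_const[of UNIV "5 / 2"]
        C1_on_scaleR[OF C1_on_const[of UNIV "1 / s"] C1_on_blinfun_compose[OF g(1), of T]]]
    by (simp add: q_def)
  from C1_on_compose_real[OF this \<theta>(1,2)] have 1: "\<exists>\<phi>'. C1_on UNIV \<phi> \<phi>'"
    unfolding \<phi>_def by blast
  have "(norm T)-lipschitz_on UNIV (blinfun_apply T)"
    using norm_blinfun[of T] by (intro lipschitz_onI) (auto simp: dist_norm simp flip: blinfun.diff_right)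
  then have "(norm T * (C * norm e))-lipschitz_on UNIV q"
    unfolding q_def by (rule lipschitz_on_compose2[OF g(2) lipschitz_on_subset]) simp
  then have "(0 + \<bar>1 / s\<bar> * (norm T * (C * norm e)))-lipschitz_on UNIV (\<lambda>x. 5 / 2 - 1 / s * q x)"
    by (intro lipschitz_on_diff lipschitz_on_constant lipschitz_on_cmult_real)
  then have 2: "\<exists>L. L-lipschitz_on UNIV \<phi>"
    unfolding \<phi>_def by (intro exI) (rule lipschitz_on_compose2[OF _ lipschitz_on_subset[OF \<theta>(3)]]; simp)
  have "cutoff \<phi>" using 1 2 \<theta>(4,5) by (simp add: cutoff_def \<phi>_def)
  moreover have "\<phi> x = 1" if "y \<in> E" "dist x y < s" for x y
  proof -
    have "q x \<le> 3 / 2 * s" using q[of x] infdist_le2[OF that(1), of x s] that(2) by linarith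
    then have "1 / s * q x \<le> 3 / 2" using \<open>s > 0\<close> by (simp add: divide_simps)
    then show ?thesis unfolding \<phi>_def by (intro \<theta>(7)) simp
  qed
  moreover have "\<phi> x = 0" if "\<And>y. y \<in> E \<Longrightarrow> 3 * s \<le> dist x y" for x
  proof -
    have "3 * s \<le> infdist x E" using that False by (auto simp: infdist_notempty intro: cINF_greatest)
    then have "q x \<ge> 5 / 2 * s" using q[of x] by linarith
    then have "1 / s * q x \<ge> 5 / 2" using \<open>s > 0\<close> by (simp add: divide_simps)
    then show ?thesis unfolding \<phi>_def by (intro \<theta>(6)) simp
  qed
  ultimately show thesis using that by blast
qed

section \<open>Local approximability is global\<close>

text \<open>
  On \<open>U\<close>, the map \<open>u\<close> is uniformly \<open>\<delta>\<close>-close to \<open>F\<close> and its derivative is close to the prescribed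
  operators \<open>D\<close> up to a tolerance \<open>\<kappa>\<close>, both only at points of \<open>S\<close>; moreover the error \<open>u - F\<close> is
  \<open>\<mu>\<close>-Lipschitz on \<open>A\<close>, up to \<open>\<delta>\<close>. The parameters allow two uses. For the first approximation of
  \<open>f\<close> one has \<open>S = A\<close>, since nothing is known off \<open>A\<close>. In the second use \<open>S\<close> is the whole space
  and \<open>\<kappa>\<close> vanishes exactly on \<open>A\<close>.
\<close>
definition approximation_on ::
    "'a::real_normed_vector set \<Rightarrow> 'a set \<Rightarrow> ('a \<Rightarrow> 'b::real_normed_vector) \<Rightarrow> ('a \<Rightarrow> 'a \<Rightarrow>\<^sub>L 'b) \<Rightarrow>
      ('a \<Rightarrow> real) \<Rightarrow> real \<Rightarrow> 'a set \<Rightarrow> real \<Rightarrow> ('a \<Rightarrow> 'b) \<Rightarrow> ('a \<Rightarrow> 'a \<Rightarrow>\<^sub>L 'b) \<Rightarrow> bool"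
  where "approximation_on S A F D \<kappa> \<mu> U \<delta> u u' \<longleftrightarrow> C1_on U u u' \<and>
    (\<forall>x\<in>S \<inter> U. norm (u x - F x) \<le> \<delta>) \<and> (\<forall>x\<in>S \<inter> U. norm (u' x - D x) \<le> \<kappa> x + \<delta>) \<and>
    (\<mu> + \<delta>)-lipschitz_on (A \<inter> U) (\<lambda>x. u x - F x)"

text \<open>
  The arbitrarily small \<open>\<delta>\<close> is what makes this notion local: chosen after a family of
  cutoffs, it can absorb their Lipschitz constants.
\<close>
definition approximable ::
    "'a::real_normed_vector set \<Rightarrow> 'a set \<Rightarrow> ('a \<Rightarrow> 'b::real_normed_vector) \<Rightarrow> ('a \<Rightarrow> 'a \<Rightarrow>\<^sub>L 'b) \<Rightarrow>
      ('a \<Rightarrow> real) \<Rightarrow> real \<Rightarrow> 'a set \<Rightarrow> bool"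
  where "approximable S A F D \<kappa> \<mu> U \<longleftrightarrow> (\<forall>\<delta>>0. \<exists>u u'. approximation_on S A F D \<kappa> \<mu> U \<delta> u u')"

lemma approximation_onD:
  assumes "approximation_on S A F D \<kappa> \<mu> U \<delta> u u'"
  shows "C1_on U u u'" "x \<in> S \<Longrightarrow> x \<in> U \<Longrightarrow> norm (u x - F x) \<le> \<delta>"
    "x \<in> S \<Longrightarrow> x \<in> U \<Longrightarrow> norm (u' x - D x) \<le> \<kappa> x + \<delta>"
    "(\<mu> + \<delta>)-lipschitz_on (A \<inter> U) (\<lambda>x. u x - F x)"
  using assms by (auto simp: approximation_on_def)

lemma approximation_onI:
  assumes "C1_on U u u'" "\<And>x. x \<in> S \<Longrightarrow> x \<in> U \<Longrightarrow> norm (u x - F x) \<le> \<delta>"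
    "\<And>x. x \<in> S \<Longrightarrow> x \<in> U \<Longrightarrow> norm (u' x - D x) \<le> \<kappa> x + \<delta>"
    "(\<mu> + \<delta>)-lipschitz_on (A \<inter> U) (\<lambda>x. u x - F x)"
  shows "approximation_on S A F D \<kappa> \<mu> U \<delta> u u'"
  using assms by (simp add: approximation_on_def)

lemma approximableE:
  assumes "approximable S A F D \<kappa> \<mu> U" "\<delta> > 0"
  obtains u u' where "approximation_on S A F D \<kappa> \<mu> U \<delta> u u'"
  using assms unfolding approximable_def by meson

lemma approximable_subset:
  assumes "approximable S A F D \<kappa> \<mu> U" "V \<subseteq> U"
  shows "approximable S A F D \<kappa> \<mu> V"
  unfolding approximable_def
proof (intro allI impI)
  fix \<delta> :: real assume "\<delta> > 0"
  then obtain u u' where u: "approximation_on S A F D \<kappa> \<mu> U \<delta> u u'"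
    by (rule approximableE[OF assms(1)])
  have "approximation_on S A F D \<kappa> \<mu> V \<delta> u u'"
  proof (rule approximation_onI)
    show "C1_on V u u'" by (rule C1_on_subset[OF approximation_onD(1)[OF u] assms(2)])
    show "(\<mu> + \<delta>)-lipschitz_on (A \<inter> V) (\<lambda>x. u x - F x)"
      by (rule lipschitz_on_subset[OF approximation_onD(4)[OF u]]) (use assms(2) in blast)
  qed (use assms(2) approximation_onD(2,3)[OF u] in blast)+
  then show "\<exists>u u'. approximation_on S A F D \<kappa> \<mu> V \<delta> u u'" by blast
qed

text \<open>
  The only new pairs of points are those in different members; they are at distance at least \<open>s\<close>,
  so a uniform error of at most \<open>\<delta> * s / 2\<close> is \<open>\<delta>\<close>-Lipschitz along them.
\<close>
lemma approximable_separated_Union: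
  fixes V :: "'i \<Rightarrow> 'a::real_normed_vector set"
  assumes loc: "\<And>i. approximable S A F D \<kappa> \<mu> (V i)" and op: "\<And>i. open (V i)"
    and sep: "\<And>i j x y. i \<noteq> j \<Longrightarrow> x \<in> V i \<Longrightarrow> y \<in> V j \<Longrightarrow> s \<le> dist x y" and "s > 0"
    and "A \<subseteq> S" "\<mu> \<ge> 0"
  shows "approximable S A F D \<kappa> \<mu> (\<Union>i. V i)"
  unfolding approximable_def
proof (intro allI impI)
  fix \<delta> :: real assume "\<delta> > 0"
  define d where "d = min \<delta> (\<delta> * s / 2)"
  have d: "d > 0" "d \<le> \<delta>" "2 * d \<le> \<delta> * s" using \<open>\<delta> > 0\<close> \<open>s > 0\<close> by (auto simp: d_def)
  have "\<forall>i. \<exists>u u'. approximation_on S A F D \<kappa> \<mu> (V i) d u u'"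
    using loc d(1) by (simp add: approximable_def)
  then obtain u u' where u: "\<And>i. approximation_on S A F D \<kappa> \<mu> (V i) d (u i) (u' i)"
    by metis
  note uD = approximation_onD[OF u]
  define i where "i = (\<lambda>x. SOME j. x \<in> V j)"
  have i: "i x = j" if "x \<in> V j" for x j
    using sep[of "i x" j x x] that \<open>s > 0\<close> someI[of "\<lambda>j. x \<in> V j" j] by (auto simp: i_def)
  have e: "norm (u (i x) x - F x) \<le> d" "norm (u' (i x) x - D x) \<le> \<kappa> x + d"
    if "x \<in> S" "x \<in> (\<Union>i. V i)" for x
    using that uD(2,3) i by auto
  have "approximation_on S A F D \<kappa> \<mu> (\<Union>i. V i) \<delta> (\<lambda>x. u (i x) x) (\<lambda>x. u' (i x) x)"
  proof (rule approximation_onI)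
    show "C1_on (\<Union>i. V i) (\<lambda>x. u (i x) x) (\<lambda>x. u' (i x) x)"
    proof (rule C1_on_locally)
      fix x assume "x \<in> (\<Union>i. V i)"
      then obtain j where "x \<in> V j" by blast
      then show "\<exists>W v v'. open W \<and> x \<in> W \<and> C1_on W v v' \<and> (\<forall>y\<in>W. u (i y) y = v y \<and> u' (i y) y = v' y)"
        using op uD(1) i by (intro exI[of _ "V j"] exI[of _ "u j"] exI[of _ "u' j"]) auto
    qed
    show "(\<mu> + \<delta>)-lipschitz_on (A \<inter> (\<Union>i. V i)) (\<lambda>x. u (i x) x - F x)"
    proof (rule lipschitz_onI)
      fix x y assume x: "x \<in> A \<inter> (\<Union>i. V i)" and y: "y \<in> A \<inter> (\<Union>i. V i)"
      then obtain j k where jk: "x \<in> V j" "y \<in> V k" by blast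
      show "dist (u (i x) x - F x) (u (i y) y - F y) \<le> (\<mu> + \<delta>) * dist x y"
      proof (cases "j = k")
        case True
        then have "dist (u (i x) x - F x) (u (i y) y - F y) \<le> (\<mu> + d) * dist x y"
          using lipschitz_onD[OF uD(4)[of j], of x y] jk i x y by auto
        also have "\<dots> \<le> (\<mu> + \<delta>) * dist x y" using d by (intro mult_right_mono) auto
        finally show ?thesis .
      next
        case False
        have "norm (u (i x) x - F x) \<le> d" "norm (u (i y) y - F y) \<le> d"
          using e(1) x y \<open>A \<subseteq> S\<close> by blast+
        then have "dist (u (i x) x - F x) (u (i y) y - F y) \<le> d + d"
          using norm_triangle_ineq4[of "u (i x) x - F x" "u (i y) y - F y"] by (simp add: dist_norm)
        also have "\<dots> \<le> \<delta> * s" using d by simp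
        also have "\<dots> \<le> (\<mu> + \<delta>) * dist x y"
          using sep[OF False jk] \<open>\<delta> > 0\<close> \<open>\<mu> \<ge> 0\<close> \<open>s > 0\<close> by (intro mult_mono) auto
        finally show ?thesis .
      qed
    qed (use \<open>\<delta> > 0\<close> \<open>\<mu> \<ge> 0\<close> in auto)
  qed (use e d in force)+
  then show "\<exists>u u'. approximation_on S A F D \<kappa> \<mu> (\<Union>i. V i) \<delta> u u'" by blast
qed

text \<open>
  Well-order the indices and let \<open>m x\<close> be the least index of a set containing \<open>x\<close>. If
  \<open>m x\<close> precedes \<open>m y\<close>, then \<open>y\<close> is not in \<open>U (m x)\<close>. This is the choice behind Stone's
  theorem that metric spaces are paracompact.
\<close>
lemma least_index_of_cover:
  fixes U :: "'i \<Rightarrow> 'a set"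
  assumes "\<And>x. \<exists>i. x \<in> U i"
  obtains m where "\<And>x. x \<in> U (m x)" "\<And>x y. m x \<noteq> m y \<Longrightarrow> x \<notin> U (m y) \<or> y \<notin> U (m x)"
proof -
  obtain r :: "'i rel" where r: "well_order_on UNIV r" using well_order_on by blast
  then have wf: "wf (r - Id)" and tot: "total r"
    by (auto simp: well_order_on_def linear_order_on_def)
  have "\<exists>i. x \<in> U i \<and> (\<forall>j. (j, i) \<in> r - Id \<longrightarrow> x \<notin> U j)" for x
    using wf assms[of x] wfE_min[of "r - Id" _ "{i. x \<in> U i}"] by (metis mem_Collect_eq)
  then obtain m where m: "\<And>x. x \<in> U (m x)" "\<And>x j. (j, m x) \<in> r - Id \<Longrightarrow> x \<notin> U j" by metis
  have "x \<notin> U (m y) \<or> y \<notin> U (m x)" if "m x \<noteq> m y" for x y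
    using tot that m(2)[of "m x" y] m(2)[of "m y" x] by (auto simp: total_on_def)
  then show thesis using that m(1) by blast
qed

lemma sum_halves_le_1: "(\<Sum>k<N. (1 / 2 :: real) ^ Suc k) \<le> 1"
proof -
  have "(\<Sum>k<N. (1 / 2 :: real) ^ Suc k) = 1 - (1 / 2) ^ N" by (induction N) auto
  then show ?thesis by simp
qed

text \<open>
  Let \<open>H\<close> be the sum of \<open>\<psi> k *\<^sub>R u k\<close>, where \<open>u k\<close> approximates \<open>F\<close> on \<open>V k\<close> with error \<open>\<epsilon> k\<close>. Since the
  \<open>\<psi> k\<close> sum to \<open>1\<close> and their derivatives to \<open>0\<close>, the difference \<open>H' x - D x\<close> is a convex combination of
  \<open>u' k x - D x\<close> plus the sum of the terms \<open>(u k x - F x)\<close> times \<open>\<psi>' k x\<close>. The latter are bounded by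
  \<open>L k * \<epsilon> k\<close>, with \<open>L k\<close> a Lipschitz constant of \<open>\<psi> k\<close>, and \<open>\<epsilon> k\<close> is chosen so that these products
  sum to at most \<open>\<delta> / 2\<close>. The same splitting, with difference quotients in place of derivatives,
  bounds the Lipschitz constant of \<open>H - F\<close> on \<open>A\<close>.
\<close>
lemma approximable_glue:
  fixes V :: "nat \<Rightarrow> 'a::real_normed_vector set" and \<psi> :: "nat \<Rightarrow> 'a \<Rightarrow> real"
  assumes loc: "\<And>k. approximable S A F D \<kappa> \<mu> (V k)" and op: "\<And>k. open (V k)"
    and \<psi>: "\<And>k. cutoff (\<psi> k)"
    and supp: "\<And>k x. x \<notin> V k \<Longrightarrow> \<forall>\<^sub>F z in nhds x. \<psi> k z = 0"
    and lf: "\<And>x. \<exists>N. \<forall>\<^sub>F z in nhds x. (\<forall>k\<ge>N. \<psi> k z = 0) \<and> (\<Sum>k<N. \<psi> k z) = 1"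
    and "A \<subseteq> S" "\<mu> \<ge> 0" and \<kappa>: "\<And>x. \<kappa> x \<ge> 0"
  shows "approximable S A F D \<kappa> \<mu> UNIV"
  unfolding approximable_def
proof (intro allI impI)
  fix \<delta> :: real assume "\<delta> > 0"
  have "\<forall>k. \<exists>\<psi>' L. C1_on UNIV (\<psi> k) \<psi>' \<and> L-lipschitz_on UNIV (\<psi> k)"
    using \<psi> by (auto simp: cutoff_def)
  then obtain \<psi>' and L :: "nat \<Rightarrow> real" where \<psi>': "\<And>k. C1_on UNIV (\<psi> k) (\<psi>' k)" and L: "\<And>k. (L k)-lipschitz_on UNIV (\<psi> k)"
    by metis
  have \<psi>01: "0 \<le> \<psi> k x" "\<psi> k x \<le> 1" for k x using \<psi> by (auto simp: cutoff_def)
  have L0: "L k \<ge> 0" for k using lipschitz_on_nonneg[OF L] .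
  have n\<psi>': "norm (\<psi>' k x) \<le> L k" for k x
    by (rule norm_derivative_le_lipschitz[OF L open_UNIV UNIV_I C1_onD(1)[OF \<psi>' UNIV_I]])
  define \<epsilon> where "\<epsilon> = (\<lambda>k. min (\<delta> / 2) (\<delta> / 2 * (1 / 2) ^ Suc k / (1 + L k)))"
  have \<epsilon>: "\<epsilon> k > 0" "\<epsilon> k \<le> \<delta> / 2" for k
    unfolding \<epsilon>_def using \<open>\<delta> > 0\<close> L0[of k] by (simp add: add_pos_nonneg) (rule min.cobounded1)
  have L\<epsilon>: "L k * \<epsilon> k \<le> \<delta> / 2 * (1 / 2) ^ Suc k" for k
  proof -
    have "L k * \<epsilon> k \<le> (1 + L k) * (\<delta> / 2 * (1 / 2) ^ Suc k / (1 + L k))"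
      using L0[of k] \<epsilon>(1)[of k] by (intro mult_mono) (auto simp: \<epsilon>_def)
    also have "\<dots> = \<delta> / 2 * (1 / 2) ^ Suc k"
      unfolding times_divide_eq_right by (rule nonzero_mult_div_cancel_left) (use L0[of k] in linarith)
    finally show ?thesis .
  qed
  have "\<forall>k. \<exists>u u'. approximation_on S A F D \<kappa> \<mu> (V k) (\<epsilon> k) u u'"
    using loc \<epsilon>(1) by (simp add: approximable_def)
  then obtain u u' where u: "\<And>k. approximation_on S A F D \<kappa> \<mu> (V k) (\<epsilon> k) (u k) (u' k)"
    by metis
  note uD = approximation_onD[OF u]
  have \<psi>'0: "\<psi>' k x = 0" if ev: "\<forall>\<^sub>F z in nhds x. \<psi> k z = 0" for k x
  proof -
    obtain O' where "open O'" "x \<in> O'" "\<And>z. z \<in> O' \<Longrightarrow> \<psi> k z = 0"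
      using ev unfolding eventually_nhds by blast
    then have "((\<lambda>_. 0) has_derivative blinfun_apply (\<psi>' k x)) (at x)"
      by (intro has_derivative_transform_within_open[OF C1_onD(1)[OF \<psi>'[of k]]]) auto
    from has_derivative_unique[OF this has_derivative_const] show ?thesis
      by (auto intro: blinfun_eqI simp: fun_eq_iff)
  qed
  have out: "\<psi> k x = 0" "\<psi>' k x = 0" if "x \<notin> V k" for k x
    using supp[OF that] \<psi>'0 eventually_nhds_x_imp_x by blast+
  define v where "v = (\<lambda>k x. \<psi> k x *\<^sub>R u k x)"
  define v' where "v' = (\<lambda>k x. if x \<in> V k then \<psi> k x *\<^sub>R u' k x + (blinfun_scaleR_left (u k x) o\<^sub>L \<psi>' k x) else 0)"
  have v'0: "v' k x = 0" if "\<forall>\<^sub>F z in nhds x. \<psi> k z = 0" for k x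
    using \<psi>'0[OF that] eventually_nhds_x_imp_x[OF that] by (simp add: v'_def)
  have C1v: "C1_on UNIV (v k) (v' k)" for k
  proof (rule C1_on_locally)
    fix x
    show "\<exists>W w w'. open W \<and> x \<in> W \<and> C1_on W w w' \<and> (\<forall>y\<in>W. v k y = w y \<and> v' k y = w' y)"
    proof (cases "x \<in> V k")
      case True
      then show ?thesis
        using op C1_on_scaleR[OF C1_on_subset[OF \<psi>'] uD(1)]
        by (intro exI[of _ "V k"] exI[of _ "v k"] exI[of _ "\<lambda>x. \<psi> k x *\<^sub>R u' k x + (blinfun_scaleR_left (u k x) o\<^sub>L \<psi>' k x)"])
           (auto simp: v_def v'_def)
    next
      case False
      then obtain W where W: "open W" "x \<in> W" "\<And>z. z \<in> W \<Longrightarrow> \<psi> k z = 0"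
        using supp[OF False] unfolding eventually_nhds by blast
      then have "v' k y = 0" if "y \<in> W" for y
        using that W unfolding eventually_nhds by (intro v'0) (auto simp: eventually_nhds)
      then show ?thesis
        using W C1_on_const[of W 0]
        by (intro exI[of _ W] exI[of _ "\<lambda>_. 0"] exI[of _ "\<lambda>_. 0"]) (auto simp: v_def)
    qed
  qed
  \<comment> \<open>Any bound \<open>n\<close> with \<open>P n x\<close> serves for the sum at \<open>x\<close>, so two points can share one.\<close>
  define P where "P = (\<lambda>N x. \<forall>\<^sub>F z in nhds x. (\<forall>k\<ge>N. \<psi> k z = 0) \<and> (\<Sum>k<N. \<psi> k z) = 1)"
  define N where "N = (\<lambda>x. SOME n. P n x)"
  have PN: "P (N x) x" for x
    unfolding N_def using lf[of x] by (intro someI_ex[of "\<lambda>n. P n x"]) (simp add: P_def)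
  have P0: "\<psi> k x = 0" "v k x = 0" "v' k x = 0" if "P n x" "k \<ge> n" for n k x
  proof -
    have "\<forall>\<^sub>F z in nhds x. \<psi> k z = 0"
      using that by (auto simp: P_def elim: eventually_mono)
    then show "\<psi> k x = 0" "v k x = 0" "v' k x = 0"
      using v'0 eventually_nhds_x_imp_x by (fastforce simp: v_def)+
  qed
  have P1: "(\<Sum>k<n. \<psi> k x) = 1" if "P n x" for n x
    using that eventually_nhds_x_imp_x by (fastforce simp: P_def)
  have Pmono: "P M x" if "P n x" "n \<le> M" for n M x
  proof -
    have "(\<Sum>k<M. \<psi> k z) = (\<Sum>k<n. \<psi> k z)" if "\<forall>k\<ge>n. \<psi> k z = 0" for z
      using that \<open>n \<le> M\<close> by (intro sum.mono_neutral_right) auto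
    with that show ?thesis by (auto simp: P_def elim!: eventually_mono)
  qed
  have \<psi>'sum: "(\<Sum>k<n. \<psi>' k x) = 0" if P: "P n x" for n x
  proof -
    obtain O' where O': "open O'" "x \<in> O'" "\<And>z. z \<in> O' \<Longrightarrow> (\<Sum>k<n. \<psi> k z) = 1"
      using P unfolding P_def eventually_nhds by blast
    have "C1_on UNIV (\<lambda>z. \<Sum>k<n. \<psi> k z) (\<lambda>z. \<Sum>k<n. \<psi>' k z)" by (intro C1_on_sum \<psi>')
    then have "((\<lambda>_. 1) has_derivative blinfun_apply (\<Sum>k<n. \<psi>' k x)) (at x)"
      by (intro has_derivative_transform_within_open[OF C1_onD(1) O'(1,2) O'(3)]) auto
    from has_derivative_unique[OF this has_derivative_const] show ?thesis
      by (auto intro: blinfun_eqI simp: fun_eq_iff)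
  qed
  define H where "H = (\<lambda>x. \<Sum>k<N x. v k x)"
  define H' where "H' = (\<lambda>x. \<Sum>k<N x. v' k x)"
  have HP: "H x = (\<Sum>k<n. v k x)" "H' x = (\<Sum>k<n. v' k x)" if "P n x" for n x
  proof -
    have "(\<Sum>k<N x. v k x) = (\<Sum>k<max (N x) n. v k x)" "(\<Sum>k<N x. v' k x) = (\<Sum>k<max (N x) n. v' k x)"
      using P0[OF PN[of x]] by (intro sum.mono_neutral_left; simp)+
    moreover have "(\<Sum>k<n. v k x) = (\<Sum>k<max (N x) n. v k x)" "(\<Sum>k<n. v' k x) = (\<Sum>k<max (N x) n. v' k x)"
      using P0[OF that] by (intro sum.mono_neutral_left; simp)+
    ultimately show "H x = (\<Sum>k<n. v k x)" "H' x = (\<Sum>k<n. v' k x)" by (simp_all add: H_def H'_def)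
  qed
  have C1H: "C1_on UNIV H H'"
  proof (rule C1_on_locally)
    fix x
    obtain W where W: "open W" "x \<in> W" "\<And>z. z \<in> W \<Longrightarrow> (\<forall>k\<ge>N x. \<psi> k z = 0) \<and> (\<Sum>k<N x. \<psi> k z) = 1"
      using PN[of x] unfolding P_def eventually_nhds by blast
    then have "P (N x) z" if "z \<in> W" for z
      using that unfolding P_def eventually_nhds by blast
    then show "\<exists>W w w'. open W \<and> x \<in> W \<and> C1_on W w w' \<and> (\<forall>y\<in>W. H y = w y \<and> H' y = w' y)"
      using W(1,2) HP C1_on_sum[of "{..<N x}" W v v'] C1_on_subset[OF C1v]
      by (intro exI[of _ W] exI[of _ "\<lambda>y. \<Sum>k<N x. v k y"] exI[of _ "\<lambda>y. \<Sum>k<N x. v' k y"]) auto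
  qed
  have val: "norm (H x - F x) \<le> \<delta>" if "x \<in> S" for x
  proof -
    have "H x - F x = (\<Sum>k<N x. \<psi> k x *\<^sub>R (u k x - F x))"
      using HP(1)[OF PN[of x]] P1[OF PN[of x]]
      by (simp add: v_def scaleR_diff_right sum_subtractf flip: scaleR_left.sum)
    also have "norm \<dots> \<le> (\<Sum>k<N x. \<psi> k x * (\<delta> / 2))"
    proof (intro sum_norm_le)
      fix k
      show "norm (\<psi> k x *\<^sub>R (u k x - F x)) \<le> \<psi> k x * (\<delta> / 2)"
      proof (cases "x \<in> V k")
        case True
        then have "norm (u k x - F x) \<le> \<delta> / 2"
          using uD(2)[of x k] \<epsilon>(2)[of k] \<open>x \<in> S\<close> by linarith
        from mult_left_mono[OF this \<psi>01(1)[of k x]] show ?thesis using \<psi>01(1)[of k x] by simp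
      qed (simp add: out(1))
    qed
    also have "\<dots> = \<delta> / 2" using P1[OF PN[of x]] by (simp only: sum_distrib_right[symmetric] mult_1)
    finally show ?thesis using \<open>\<delta> > 0\<close> by simp
  qed
  have errsum: "(\<Sum>k<n. L k * \<epsilon> k) \<le> \<delta> / 2" for n
  proof -
    have "(\<Sum>k<n. L k * \<epsilon> k) \<le> \<delta> / 2 * (\<Sum>k<n. (1 / 2) ^ Suc k)"
      unfolding sum_distrib_left by (intro sum_mono L\<epsilon>)
    also have "\<dots> \<le> \<delta> / 2 * 1"
      using \<open>\<delta> > 0\<close> sum_halves_le_1[of n] by (intro mult_left_mono) auto
    finally show ?thesis by simp
  qed
  have der: "norm (H' x - D x) \<le> \<kappa> x + \<delta>" if "x \<in> S" for x
  proof -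
    define w where "w = (\<lambda>k. v' k x - \<psi> k x *\<^sub>R D x - (blinfun_scaleR_left (F x) o\<^sub>L \<psi>' k x))"
    have "(\<Sum>k<N x. blinfun_scaleR_left (F x) o\<^sub>L \<psi>' k x) = blinfun_scaleR_left (F x) o\<^sub>L (\<Sum>k<N x. \<psi>' k x)"
      by (simp add: bounded_bilinear.sum_right[OF bounded_bilinear_blinfun_compose])
    then have "H' x - D x = (\<Sum>k<N x. w k)"
      using HP(2)[OF PN[of x]] P1[OF PN[of x]] \<psi>'sum[OF PN[of x]]
      by (simp add: w_def sum_subtractf bounded_bilinear.zero_right[OF bounded_bilinear_blinfun_compose] flip: scaleR_left.sum)
    also have "norm \<dots> \<le> (\<Sum>k<N x. \<psi> k x * (\<kappa> x + \<delta> / 2) + L k * \<epsilon> k)"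
    proof (intro sum_norm_le)
      fix k
      show "norm (w k) \<le> \<psi> k x * (\<kappa> x + \<delta> / 2) + L k * \<epsilon> k"
      proof (cases "x \<in> V k")
        case True
        have "w k = \<psi> k x *\<^sub>R (u' k x - D x) + (blinfun_scaleR_left (u k x - F x) o\<^sub>L \<psi>' k x)"
          using True by (intro blinfun_eqI)
            (simp add: w_def v'_def plus_blinfun.rep_eq minus_blinfun.rep_eq scaleR_blinfun.rep_eq algebra_simps)
        also have "norm \<dots> \<le> \<psi> k x * norm (u' k x - D x) + norm (u k x - F x) * norm (\<psi>' k x)"
        proof (intro norm_triangle_le add_mono)
          have "norm (blinfun_scaleR_left (u k x - F x)) \<le> norm (u k x - F x)"
            by (rule norm_blinfun_bound) auto
          then show "norm (blinfun_scaleR_left (u k x - F x) o\<^sub>L \<psi>' k x) \<le> norm (u k x - F x) * norm (\<psi>' k x)"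
            by (intro order_trans[OF norm_blinfun_compose]) (simp add: mult_right_mono)
        qed (use \<psi>01 in simp)
        also have "\<dots> \<le> \<psi> k x * (\<kappa> x + \<delta> / 2) + \<epsilon> k * L k"
        proof (intro add_mono mult_left_mono mult_mono)
          show "norm (u' k x - D x) \<le> \<kappa> x + \<delta> / 2"
            using uD(3)[of x k] True \<open>x \<in> S\<close> \<epsilon>(2)[of k] by linarith
        qed (use uD(2)[of x k] True \<open>x \<in> S\<close> \<psi>01[of k x] \<epsilon>(1)[of k] n\<psi>'[of k x] in auto)
        finally show ?thesis by (simp add: mult.commute)
      next
        case False
        then have "w k = 0"
          using out[OF False] by (simp add: w_def v'_def)
        then show ?thesis
          using \<psi>01[of k x] \<kappa>[of x] \<open>\<delta> > 0\<close> L0[of k] \<epsilon>(1)[of k] by simp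
      qed
    qed
    also have "\<dots> = \<kappa> x + \<delta> / 2 + (\<Sum>k<N x. L k * \<epsilon> k)"
      using P1[OF PN[of x]] by (simp only: sum.distrib sum_distrib_right[symmetric] mult_1)
    also have "\<dots> \<le> \<kappa> x + \<delta>" using errsum[of "N x"] by simp
    finally show ?thesis .
  qed
  have lip: "(\<mu> + \<delta>)-lipschitz_on A (\<lambda>x. H x - F x)"
  proof (rule lipschitz_onI)
    fix x y assume xy: "x \<in> A" "y \<in> A"
    define n where "n = max (N x) (N y)"
    have P: "P n x" "P n y" unfolding n_def by (rule Pmono[OF PN], simp)+
    define e where "e = (\<lambda>k z. \<psi> k z *\<^sub>R (u k z - F z))"
    have He: "H z - F z = (\<Sum>k<n. e k z)" if "P n z" for z
      using HP(1)[OF that] P1[OF that]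
      by (simp add: e_def v_def scaleR_diff_right sum_subtractf flip: scaleR_left.sum)
    have small: "norm (u k z - F z) \<le> \<epsilon> k" if "z \<in> A" "z \<in> V k" for k z
      using uD(2)[of z k] that \<open>A \<subseteq> S\<close> by auto
    have \<psi>L: "\<bar>\<psi> k x - \<psi> k y\<bar> \<le> L k * dist x y" for k
      using lipschitz_onD[OF L[of k], of x y] by (simp add: dist_real_def)
    \<comment> \<open>If only one of the points is in \<open>V k\<close>, then \<open>\<psi> k\<close> vanishes at the other
      and its Lipschitz estimate suffices.\<close>
    have summand: "norm (e k x - e k y) \<le> (\<psi> k x * (\<mu> + \<delta> / 2) + L k * \<epsilon> k) * dist x y" for k
    proof -
      have 0: "0 \<le> \<psi> k x * (\<mu> + \<delta> / 2) * dist x y"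
        using \<psi>01[of k x] \<open>\<mu> \<ge> 0\<close> \<open>\<delta> > 0\<close> by simp
      consider "x \<in> V k" "y \<in> V k" | "x \<notin> V k" "y \<in> V k" | "y \<notin> V k" "x \<in> V k" | "x \<notin> V k" "y \<notin> V k" by blast
      then show ?thesis
      proof cases
        case 1
        have "e k x - e k y = \<psi> k x *\<^sub>R ((u k x - F x) - (u k y - F y)) + (\<psi> k x - \<psi> k y) *\<^sub>R (u k y - F y)"
          by (simp add: e_def algebra_simps)
        also have "norm \<dots> \<le> \<psi> k x * ((\<mu> + \<delta> / 2) * dist x y) + (L k * dist x y) * \<epsilon> k"
        proof (intro norm_triangle_le add_mono)
          have "norm ((u k x - F x) - (u k y - F y)) \<le> (\<mu> + \<epsilon> k) * dist x y"
            using lipschitz_onD[OF uD(4)[of k], of x y] 1 xy by (simp add: dist_norm)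
          also have "\<dots> \<le> (\<mu> + \<delta> / 2) * dist x y" using \<epsilon>(2)[of k] by (intro mult_right_mono) auto
          finally show "norm (\<psi> k x *\<^sub>R ((u k x - F x) - (u k y - F y))) \<le> \<psi> k x * ((\<mu> + \<delta> / 2) * dist x y)"
            using \<psi>01[of k x] by (simp add: mult_left_mono)
          show "norm ((\<psi> k x - \<psi> k y) *\<^sub>R (u k y - F y)) \<le> (L k * dist x y) * \<epsilon> k"
            using \<psi>L[of k] small[of y k] xy 1 L0[of k] by (simp add: mult_mono)
        qed
        finally show ?thesis by (simp add: algebra_simps)
      next
        case 2
        have "norm (e k x - e k y) = \<bar>\<psi> k x - \<psi> k y\<bar> * norm (u k y - F y)"
          using out(1)[OF 2(1)] by (simp add: e_def)
        also have "\<dots> \<le> (L k * dist x y) * \<epsilon> k"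
          using \<psi>L[of k] small[of y k] xy 2 L0[of k] by (intro mult_mono) auto
        finally show ?thesis using 0 by (simp add: algebra_simps)
      next
        case 3
        have "norm (e k x - e k y) = \<bar>\<psi> k x - \<psi> k y\<bar> * norm (u k x - F x)"
          using out(1)[OF 3(1)] by (simp add: e_def)
        also have "\<dots> \<le> (L k * dist x y) * \<epsilon> k"
          using \<psi>L[of k] small[of x k] xy 3 L0[of k] by (intro mult_mono) auto
        finally show ?thesis using 0 by (simp add: algebra_simps)
      next
        case 4
        then have "norm (e k x - e k y) = 0" using out(1) by (simp add: e_def)
        moreover have "0 \<le> L k * \<epsilon> k * dist x y" using L0[of k] \<epsilon>(1)[of k] by simp
        ultimately show ?thesis using 0 by (simp add: algebra_simps)
      qed
    qed
    have "dist (H x - F x) (H y - F y) = norm (\<Sum>k<n. e k x - e k y)"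
      using He[OF P(1)] He[OF P(2)] by (simp add: dist_norm sum_subtractf)
    also have "\<dots> \<le> (\<Sum>k<n. (\<psi> k x * (\<mu> + \<delta> / 2) + L k * \<epsilon> k) * dist x y)"
      by (intro sum_norm_le summand)
    also have "\<dots> = (\<mu> + \<delta> / 2 + (\<Sum>k<n. L k * \<epsilon> k)) * dist x y"
      using P1[OF P(1)] by (simp only: sum.distrib sum_distrib_right[symmetric] mult_1)
    also have "\<dots> \<le> (\<mu> + \<delta>) * dist x y"
      using errsum[of n] by (intro mult_right_mono) auto
    finally show "dist (H x - F x) (H y - F y) \<le> (\<mu> + \<delta>) * dist x y" .
  qed (use \<open>\<mu> \<ge> 0\<close> \<open>\<delta> > 0\<close> in auto)
  have "approximation_on S A F D \<kappa> \<mu> UNIV \<delta> H H'"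
    by (rule approximation_onI) (use C1H val der lip in auto)
  then show "\<exists>u u'. approximation_on S A F D \<kappa> \<mu> UNIV \<delta> u u'" by blast
qed

lemma sum_telescoping_prod:
  fixes a :: "nat \<Rightarrow> real"
  shows "(\<Sum>j<n. a j * (\<Prod>i<j. 1 - a i)) = 1 - (\<Prod>j<n. 1 - a j)"
  by (induction n) (auto simp: algebra_simps)

text \<open>
  Every point lies in some \<open>E k\<close>, the set of points \<open>x\<close> whose ball of radius \<open>r k\<close> is contained in
  \<open>U (m x)\<close>, with \<open>m\<close> the least index. Points of \<open>E k\<close> with different indices are \<open>r k\<close> apart, so the
  \<open>r k / 3\<close>-neighbourhood \<open>V k\<close> of \<open>E k\<close> is a separated union of subsets of the \<open>U i\<close> and hence
  approximable. An arbitrary cover has thus been replaced by a countable one, and the core \<open>E k\<close>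
  of each member has positive distance to the complement, which is what Lipschitz cutoffs require.
\<close>
lemma approximable_UNIV_if_locally:
  fixes F :: "'a::banach \<Rightarrow> 'b::banach" and e :: 'b
  assumes C: "lipschitz_smoothing C TYPE('a) TYPE('b)" and "e \<noteq> 0"
    and loc: "\<And>x. \<exists>U. open U \<and> x \<in> U \<and> approximable S A F D \<kappa> \<mu> U"
    and "A \<subseteq> S" "\<mu> \<ge> 0" "\<And>x. \<kappa> x \<ge> 0"
  shows "approximable S A F D \<kappa> \<mu> UNIV"
proof -
  obtain U where U: "\<And>x. open (U x)" "\<And>x. x \<in> U x" "\<And>x. approximable S A F D \<kappa> \<mu> (U x)"
    using loc by metis
  obtain m where m: "\<And>x. x \<in> U (m x)" "\<And>x y. m x \<noteq> m y \<Longrightarrow> x \<notin> U (m y) \<or> y \<notin> U (m x)"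
    using least_index_of_cover[of U] U(2) by metis
  define r where "r = (\<lambda>k. inverse (real (Suc k)))"
  have r: "r k > 0" for k by (simp add: r_def)
  define E where "E = (\<lambda>k. {x. ball x (r k) \<subseteq> U (m x)})"
  define W where "W = (\<lambda>k i. \<Union>y\<in>{y \<in> E k. m y = i}. ball y (r k / 3))"
  define V where "V = (\<lambda>k. \<Union>i. W k i)"
  have sepE: "r k \<le> dist x y" if "x \<in> E k" "y \<in> E k" "m x \<noteq> m y" for k x y
  proof (rule ccontr)
    assume "\<not> r k \<le> dist x y"
    then have "y \<in> ball x (r k)" "x \<in> ball y (r k)" by (auto simp: dist_commute)
    then show False using that m(2)[OF that(3)] by (auto simp: E_def)
  qed
  have sepW: "r k / 3 \<le> dist x y" if xy: "i \<noteq> j" "x \<in> W k i" "y \<in> W k j" for k i j x y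
  proof -
    obtain x' where x': "x' \<in> E k" "m x' = i" "dist x' x < r k / 3"
      using xy(2) unfolding W_def by auto
    obtain y' where y': "y' \<in> E k" "m y' = j" "dist y' y < r k / 3"
      using xy(3) unfolding W_def by auto
    have "m x' \<noteq> m y'" using x' y' xy(1) by simp
    note * = x'(1) y'(1) this x'(3) y'(3)
    have "r k \<le> dist x' x + dist x y + dist y' y"
      using sepE[OF *(1-3)] dist_triangle[of x' y' x] dist_triangle[of x y' y] by (simp add: dist_commute)
    then show ?thesis using * by linarith
  qed
  have WU: "W k i \<subseteq> U i" for k i
  proof
    fix x assume "x \<in> W k i"
    then obtain y where "y \<in> E k" "m y = i" "dist y x < r k / 3" by (auto simp: W_def)
    then show "x \<in> U i" using r[of k] by (auto simp: E_def subset_eq)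
  qed
  have opW: "open (W k i)" for k i unfolding W_def by blast
  have appV: "approximable S A F D \<kappa> \<mu> (V k)" for k
    unfolding V_def
    by (rule approximable_separated_Union[where s = "r k / 3", OF approximable_subset[OF U(3) WU]])
      (use opW sepW r assms(4-6) in auto)
  have opV: "open (V k)" for k unfolding V_def using opW by blast
  have "\<exists>\<phi>. cutoff \<phi> \<and> (\<forall>x y. y \<in> E k \<longrightarrow> dist x y < r k / 12 \<longrightarrow> \<phi> x = 1) \<and>
      (\<forall>x. (\<forall>y\<in>E k. 3 * (r k / 12) \<le> dist x y) \<longrightarrow> \<phi> x = 0)" for k
    by (rule exists_cutoff[OF C \<open>e \<noteq> 0\<close>, of "r k / 12" "E k"]) (use r in auto)
  then obtain \<phi> where \<phi>: "\<And>k. cutoff (\<phi> k)"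
      "\<And>k x y. y \<in> E k \<Longrightarrow> dist x y < r k / 12 \<Longrightarrow> \<phi> k x = 1"
      "\<And>k x. \<forall>y\<in>E k. 3 * (r k / 12) \<le> dist x y \<Longrightarrow> \<phi> k x = 0"
    by metis
  \<comment> \<open>Near a point where \<open>\<phi> k = 1\<close> all later \<open>\<psi> j\<close> vanish and the first \<open>k + 1\<close> of them sum to 1.\<close>
  define \<psi> where "\<psi> = (\<lambda>k x. \<phi> k x * (\<Prod>j<k. 1 - \<phi> j x))"
  show ?thesis
  proof (rule approximable_glue[where V = V and \<psi> = \<psi>])
    show "cutoff (\<psi> k)" for k
      unfolding \<psi>_def by (intro cutoff_mult cutoff_prod cutoff_complement \<phi>(1))
    show "\<forall>\<^sub>F z in nhds x. \<psi> k z = 0" if "x \<notin> V k" for k x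
    proof -
      have "\<phi> k z = 0" if z: "z \<in> ball x (r k / 12)" for z
      proof (intro \<phi>(3) ballI)
        fix y assume "y \<in> E k"
        then have "r k / 3 \<le> dist y x" using \<open>x \<notin> V k\<close> by (force simp: V_def W_def)
        also have "\<dots> \<le> dist z y + dist x z" using dist_triangle[of y x z] by (simp add: dist_commute)
        finally show "3 * (r k / 12) \<le> dist z y" using z by simp
      qed
      then show ?thesis using r[of k] by (auto simp: eventually_nhds \<psi>_def intro!: exI[of _ "ball x (r k / 12)"])
    qed
    show "\<exists>N. \<forall>\<^sub>F z in nhds x. (\<forall>k\<ge>N. \<psi> k z = 0) \<and> (\<Sum>k<N. \<psi> k z) = 1" for x
    proof -
      obtain \<epsilon> where \<epsilon>: "\<epsilon> > 0" "ball x \<epsilon> \<subseteq> U (m x)" using U(1) m(1) open_contains_ball by blast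
      obtain k where "r k < \<epsilon>" using reals_Archimedean[OF \<epsilon>(1)] by (auto simp: r_def)
      then have "x \<in> E k" using \<epsilon>(2) by (auto simp: E_def)
      have "(\<forall>j\<ge>Suc k. \<psi> j z = 0) \<and> (\<Sum>j<Suc k. \<psi> j z) = 1" if "z \<in> ball x (r k / 12)" for z
      proof -
        have 1: "\<phi> k z = 1" using \<phi>(2)[OF \<open>x \<in> E k\<close>, of z] that by (simp add: dist_commute)
        have prod0: "(\<Prod>i<j. 1 - \<phi> i z) = 0" if "j \<ge> Suc k" for j
          using that 1 by (intro prod_zero) (auto intro!: bexI[of _ k])
        have "\<forall>j\<ge>Suc k. \<psi> j z = 0" unfolding \<psi>_def using prod0 by simp
        moreover have "(\<Sum>j<Suc k. \<psi> j z) = 1"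
          unfolding \<psi>_def sum_telescoping_prod by (simp only: prod0[OF order_refl])
        ultimately show ?thesis ..
      qed
      then show ?thesis using r[of k]
        by (auto simp: eventually_nhds intro!: exI[of _ "Suc k"] exI[of _ "ball x (r k / 12)"])
    qed
  qed (use appV opV assms in auto)
qed

section \<open>Lipschitz extension\<close>

text \<open>
  A segment joining two points is covered by two closed sets, and on an interval the Lipschitz
  constant of a finite closed cover is inherited.
\<close>
lemma lipschitz_on_UNIV_closed_cover:
  fixes f :: "'a::real_normed_vector \<Rightarrow> 'b::metric_space"
  assumes "M-lipschitz_on P f" "M-lipschitz_on Q f" "closed P" "closed Q" "P \<union> Q = UNIV"
  shows "M-lipschitz_on UNIV f"
proof (rule lipschitz_onI)
  show M: "0 \<le> M" using assms(1) by (rule lipschitz_on_nonneg)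
  fix x y :: 'a
  define \<gamma> where "\<gamma> = (\<lambda>t. x + t *\<^sub>R (y - x))"
  have \<gamma>: "dist (\<gamma> s) (\<gamma> t) = norm (y - x) * dist s t" for s t
  proof -
    have "\<gamma> s - \<gamma> t = (s - t) *\<^sub>R (y - x)" by (simp add: \<gamma>_def algebra_simps)
    then show ?thesis by (simp add: dist_norm)
  qed
  have cl: "closed (\<gamma> -` R)" if "closed R" for R
    using that unfolding \<gamma>_def by (intro closed_vimage continuous_intros)
  have "(M * norm (y - x))-lipschitz_on (\<gamma> -` R) (\<lambda>t. f (\<gamma> t))" if "M-lipschitz_on R f" for R
  proof (rule lipschitz_onI)
    fix s t assume "s \<in> \<gamma> -` R" "t \<in> \<gamma> -` R"
    then show "dist (f (\<gamma> s)) (f (\<gamma> t)) \<le> M * norm (y - x) * dist s t"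
      using lipschitz_onD[OF that, of "\<gamma> s" "\<gamma> t"] \<gamma>[of s t] by (simp add: mult.assoc)
  qed (use M in simp)
  then have "(M * norm (y - x))-lipschitz_on {0..1} (\<lambda>t. f (\<gamma> t))"
    using assms cl M
    by (intro lipschitz_on_closed_Union[where I = "{P, Q}" and U = "\<lambda>R. \<gamma> -` R"]) auto
  from lipschitz_onD[OF this, of 0 1] show "dist (f x) (f y) \<le> M * dist x y"
    by (simp add: \<gamma>_def dist_norm norm_minus_commute)
qed

text \<open>
  Let \<open>g n\<close> approximate \<open>f\<close> on \<open>A\<close> with error of order \<open>r n = 2\<^sup>-\<^sup>n\<close> and with the uniform Lipschitz
  bound \<open>C * L\<close>. Passing from \<open>g n\<close> to \<open>g (Suc n)\<close> in the layer where the distance \<open>d\<close> to \<open>A\<close> lies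
  between \<open>r n / 2\<close> and \<open>r n\<close> costs only a constant factor: there \<open>g (Suc n)\<close> and \<open>g n\<close> differ by a multiple
  of \<open>L * r n\<close>, while the transition function has Lipschitz constant \<open>2 / r n\<close>. The layers for
  different \<open>n\<close> do not overlap, so the bounds do not accumulate.
\<close>
lemma lipschitz_extension:
  fixes f :: "'a::banach \<Rightarrow> 'b::banach"
  assumes C: "lipschitz_smoothing C TYPE('a) TYPE('b)" and f: "L-lipschitz_on A f" and "L > 0"
  obtains F where "(11 * C * L)-lipschitz_on UNIV F" "\<And>x. x \<in> A \<Longrightarrow> F x = f x"
proof (cases "A = {}")
  case True
  have "0-lipschitz_on UNIV (\<lambda>_ :: 'a. 0 :: 'b)" by (rule lipschitz_on_constant)
  moreover have "0 \<le> 11 * C * L" using C \<open>L > 0\<close> by (simp add: lipschitz_smoothing_def)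
  ultimately show thesis
    using that True lipschitz_on_mono[OF _ subset_refl] by blast
next
  case False
  have "C \<ge> 1" using C by (simp add: lipschitz_smoothing_def)
  define r where "r = (\<lambda>n. (1 / 2 :: real) ^ n)"
  have r: "r n > 0" "r (Suc n) = r n / 2" for n by (simp_all add: r_def)
  have "\<exists>g. (C * L)-lipschitz_on UNIV g \<and> (\<forall>x\<in>A. norm (g x - f x) \<le> L * r n / 2)" for n
    by (rule lipschitz_smoothingE[OF C f, of "L * r n / 2"]) (use \<open>L > 0\<close> r in auto)
  then obtain g where g: "\<And>n. (C * L)-lipschitz_on UNIV (g n)"
      "\<And>n x. x \<in> A \<Longrightarrow> norm (g n x - f x) \<le> L * r n / 2"
    by metis
  define d where "d = (\<lambda>x. infdist x A)"
  have d1: "\<bar>d x - d y\<bar> \<le> dist x y" for x y unfolding d_def by (rule infdist_triangle_abs)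
  have dcont: "continuous_on UNIV d" unfolding d_def by (intro continuous_intros)
  define \<theta> where "\<theta> = (\<lambda>n x. max 0 (min 1 (2 - 2 * (d x / r n))))"
  have \<theta>01: "0 \<le> \<theta> n x" "\<theta> n x \<le> 1" for n x by (auto simp: \<theta>_def)
  have \<theta>0: "\<theta> n x = 0" if "d x \<ge> r n" for n x
    using that r(1)[of n] by (simp add: \<theta>_def field_simps)
  have \<theta>1: "\<theta> n x = 1" if "d x \<le> r (Suc n)" for n x
    using that r[of n] by (simp add: \<theta>_def field_simps)
  have \<theta>L: "\<bar>\<theta> n x - \<theta> n y\<bar> \<le> 2 / r n * dist x y" for n x y
  proof -
    have "\<bar>max 0 (min 1 (2 - a)) - max 0 (min 1 (2 - b))\<bar> \<le> \<bar>a - b\<bar>" for a b :: real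
      by (simp add: max_def min_def abs_if)
    then have "\<bar>\<theta> n x - \<theta> n y\<bar> \<le> \<bar>2 * (d x / r n) - 2 * (d y / r n)\<bar>"
      unfolding \<theta>_def .
    also have "2 * (d x / r n) - 2 * (d y / r n) = 2 / r n * (d x - d y)"
      by (simp add: right_diff_distrib)
    also have "\<bar>\<dots>\<bar> = 2 / r n * \<bar>d x - d y\<bar>"
      using r(1)[of n] by (simp only: abs_mult) simp
    also have "\<dots> \<le> 2 / r n * dist x y"
      using d1[of x y] r(1)[of n] by (intro mult_left_mono) auto
    finally show ?thesis .
  qed
  have close: "norm (g (Suc n) x - g n x) \<le> (4 * C + 1) * L * r n" if dx: "d x \<le> r n" for n x
  proof -
    have "infdist x A < 2 * r n" using dx r(1)[of n] by (simp add: d_def)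
    then obtain a where a: "a \<in> A" "dist x a < 2 * r n"
      using False by (auto simp: infdist_notempty cINF_less_iff)
    have "norm (g (Suc n) x - g n x) \<le> norm (g (Suc n) x - g (Suc n) a) + norm (g n x - g n a)
        + (norm (g (Suc n) a - f a) + norm (g n a - f a))"
      using norm_triangle_ineq4[of "g (Suc n) x - g (Suc n) a" "g n x - g n a"]
        norm_triangle_ineq4[of "g (Suc n) a - f a" "g n a - f a"]
        norm_triangle_ineq[of "(g (Suc n) x - g (Suc n) a) - (g n x - g n a)" "(g (Suc n) a - f a) - (g n a - f a)"]
      by simp
    also have "\<dots> \<le> C * L * (2 * r n) + C * L * (2 * r n) + (L * r n + L * r n) / 2"
    proof -
      have "norm (g k x - g k a) \<le> C * L * (2 * r n)" for k
        using lipschitz_on_normD[OF g(1)[of k], of x a] a(2) \<open>C \<ge> 1\<close> \<open>L > 0\<close>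
        by (smt (verit) UNIV_I dist_norm mult_left_mono mult_nonneg_nonneg)
      moreover have "norm (g (Suc n) a - f a) \<le> L * r n / 2" "norm (g n a - f a) \<le> L * r n / 2"
        using g(2)[OF a(1), of "Suc n"] g(2)[OF a(1), of n] mult_pos_pos[OF \<open>L > 0\<close> r(1)[of n]]
        by (simp_all add: r(2))
      ultimately show ?thesis by (smt (verit) field_sum_of_halves)
    qed
    also have "\<dots> = (4 * C + 1) * L * r n" by (simp add: algebra_simps)
    finally show ?thesis .
  qed
  define t where "t = (\<lambda>n x. \<theta> n x *\<^sub>R (g (Suc n) x - g n x))"
  define G where "G = (\<lambda>n x. g 0 x + (\<Sum>k<n. t k x))"
  \<comment> \<open>Close to \<open>A\<close> all transitions are complete and the sum telescopes.\<close>
  have Gg: "G n x = g n x" if "d x \<le> r n" for n x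
    using that
  proof (induction n)
    case (Suc n)
    have "d x \<le> r n" using Suc.prems r[of n] by simp
    then show ?case using Suc \<theta>1[OF Suc.prems] by (simp add: G_def t_def algebra_simps)
  qed (simp add: G_def)
  define M where "M = C * L + 2 * (4 * C + 1) * L"
  have M: "C * L \<le> M" "0 \<le> M" using \<open>C \<ge> 1\<close> \<open>L > 0\<close> by (auto simp: M_def)
  have GL: "M-lipschitz_on UNIV (G n)" for n
  proof (induction n)
    case 0
    show ?case using lipschitz_on_mono[OF g(1)[of 0] _ M(1)] by (simp add: G_def)
  next
    case (Suc n)
    show ?case
    proof (rule lipschitz_on_UNIV_closed_cover)
      show "closed {x. r n \<le> d x}" "closed {x. d x \<le> r n}"
        using dcont by (auto intro!: closed_Collect_le continuous_intros)
      have "M-lipschitz_on {x. r n \<le> d x} (G n)" by (rule lipschitz_on_subset[OF Suc]) simp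
      then show "M-lipschitz_on {x. r n \<le> d x} (G (Suc n))"
        by (rule lipschitz_on_transform) (simp add: G_def t_def \<theta>0)
      show "M-lipschitz_on {x. d x \<le> r n} (G (Suc n))"
      proof (rule lipschitz_onI)
        fix x y assume x: "x \<in> {x. d x \<le> r n}" and y: "y \<in> {x. d x \<le> r n}"
        have eq: "G (Suc n) z = g n z + \<theta> n z *\<^sub>R (g (Suc n) z - g n z)" if "d z \<le> r n" for z
          using Gg[OF that] by (simp add: G_def t_def)
        have "G (Suc n) x - G (Suc n) y = (1 - \<theta> n x) *\<^sub>R (g n x - g n y)
            + \<theta> n x *\<^sub>R (g (Suc n) x - g (Suc n) y) + (\<theta> n x - \<theta> n y) *\<^sub>R (g (Suc n) y - g n y)"
          using x y by (simp add: eq algebra_simps)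
        also have "norm \<dots> \<le> (1 - \<theta> n x) * (C * L * dist x y) + \<theta> n x * (C * L * dist x y)
            + (2 / r n * dist x y) * ((4 * C + 1) * L * r n)"
        proof (intro norm_triangle_le add_mono)
          have gL: "norm (g k x - g k y) \<le> C * L * dist x y" for k
            using lipschitz_on_normD[OF g(1)[of k], of x y] by (simp add: dist_norm)
          show "norm ((1 - \<theta> n x) *\<^sub>R (g n x - g n y)) \<le> (1 - \<theta> n x) * (C * L * dist x y)"
            using \<theta>01[of n x] gL by (simp add: mult_left_mono)
          show "norm (\<theta> n x *\<^sub>R (g (Suc n) x - g (Suc n) y)) \<le> \<theta> n x * (C * L * dist x y)"
            using \<theta>01[of n x] gL by (simp add: mult_left_mono)
          show "norm ((\<theta> n x - \<theta> n y) *\<^sub>R (g (Suc n) y - g n y))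
              \<le> (2 / r n * dist x y) * ((4 * C + 1) * L * r n)"
            using \<theta>L[of n x y] close[of y n] y r(1)[of n] unfolding norm_scaleR
            by (intro mult_mono) auto
        qed
        also have "\<dots> = M * dist x y"
          using r(1)[of n] by (simp add: M_def field_simps)
        finally show "dist (G (Suc n) x) (G (Suc n) y) \<le> M * dist x y" by (simp add: dist_norm)
      qed (rule M)
    qed auto
  qed
  have "summable (\<lambda>n. t n x)" for x
  proof (rule summable_comparison_test')
    show "summable (\<lambda>n. (4 * C + 1) * L * r n)"
      unfolding r_def by (intro summable_mult summable_geometric) simp
    show "norm (t n x) \<le> (4 * C + 1) * L * r n" if "n \<ge> 0" for n
    proof (cases "d x \<le> r n")
      case True
      have "norm (t n x) \<le> 1 * norm (g (Suc n) x - g n x)"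
        unfolding t_def using \<theta>01[of n x] by (simp add: mult_left_le_one_le)
      then show ?thesis using close[OF True] by simp
    next
      case False
      then show ?thesis using \<theta>0[of n x] \<open>C \<ge> 1\<close> \<open>L > 0\<close> r(1)[of n] by (simp add: t_def)
    qed
  qed
  then have lim: "(\<lambda>n. G n x) \<longlonglongrightarrow> g 0 x + (\<Sum>n. t n x)" for x
    unfolding G_def by (intro tendsto_intros summable_LIMSEQ)
  define F where "F = (\<lambda>x. g 0 x + (\<Sum>n. t n x))"
  have "M-lipschitz_on UNIV F"
  proof (rule lipschitz_onI)
    fix x y
    have "(\<lambda>n. dist (G n x) (G n y)) \<longlonglongrightarrow> dist (F x) (F y)"
      unfolding F_def by (intro tendsto_dist lim)
    then show "dist (F x) (F y) \<le> M * dist x y"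
      by (rule LIMSEQ_le_const2) (use lipschitz_onD[OF GL] in auto)
  qed (rule M)
  moreover have "M \<le> 11 * C * L" using \<open>C \<ge> 1\<close> \<open>L > 0\<close> by (simp add: M_def algebra_simps)
  ultimately have "(11 * C * L)-lipschitz_on UNIV F" using lipschitz_on_mono by blast
  moreover have "F x = f x" if "x \<in> A" for x
  proof (rule LIMSEQ_unique)
    show "(\<lambda>n. G n x) \<longlonglongrightarrow> F x" using lim by (simp add: F_def)
    have "d x = 0" using that by (simp add: d_def)
    then have "G n x = g n x" for n using r(1)[of n] by (intro Gg) simp
    moreover have "(\<lambda>n. g n x) \<longlonglongrightarrow> f x"
    proof (rule Lim_null_comparison[THEN LIM_zero_cancel])
      show "\<forall>\<^sub>F n in sequentially. norm (g n x - f x) \<le> L * r n / 2"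
        using g(2)[OF that] by simp
      have "(\<lambda>n. r n) \<longlonglongrightarrow> 0" unfolding r_def by (rule LIMSEQ_power_zero) simp
      then show "(\<lambda>n. L * r n / 2) \<longlonglongrightarrow> 0" by (auto intro!: tendsto_eq_intros)
    qed
    ultimately show "(\<lambda>n. G n x) \<longlonglongrightarrow> f x" by simp
  qed
  ultimately show thesis using that by blast
qed

text \<open>
  Around each \<open>a \<in> A\<close> take a ball of radius \<open>\<rho> a\<close> on which the derivative is bounded by \<open>c\<close>, and let \<open>W\<close>
  be the union of the balls of a quarter of that radius. Two points of \<open>W\<close> either lie in a
  common ball, where the mean value inequality applies, or their distance is at least twice that to
  the centres of their balls; then the path through the two centres, which lie in \<open>A\<close>, is
  at most three times as long as the segment.
\<close>
lemma C1_lipschitz_near_set: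
  assumes h: "C1_on UNIV h h'" and lip: "c-lipschitz_on A h" and der: "\<And>x. x \<in> A \<Longrightarrow> norm (h' x) < c"
  obtains W where "open W" "A \<subseteq> W" "(3 * c)-lipschitz_on W h" "\<And>x. x \<in> W \<Longrightarrow> norm (h' x) \<le> c"
proof -
  have c: "c \<ge> 0" using lip by (rule lipschitz_on_nonneg)
  define U where "U = {x. norm (h' x) < c}"
  have "open U"
    unfolding U_def using C1_onD(2)[OF h] by (intro open_Collect_less continuous_intros)
  then have "\<exists>r>0. ball a r \<subseteq> U" if "a \<in> A" for a
    using der[OF that] by (auto simp: U_def open_contains_ball)
  then obtain \<rho> where \<rho>: "\<And>a. a \<in> A \<Longrightarrow> \<rho> a > 0" "\<And>a. a \<in> A \<Longrightarrow> ball a (\<rho> a) \<subseteq> U" by metis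
  define W where "W = (\<Union>a\<in>A. ball a (\<rho> a / 4))"
  have ballL: "c-lipschitz_on (ball a (\<rho> a)) h" if "a \<in> A" for a
    using \<rho>(2)[OF that] c
    by (intro lipschitz_on_convex_of_derivative[OF C1_on_subset[OF h]]) (auto simp: U_def)
  have key: "dist (h x) (h y) \<le> 3 * c * dist x y"
    if ab: "a \<in> A" "b \<in> A" "x \<in> ball a (\<rho> a / 4)" "y \<in> ball b (\<rho> b / 4)" "\<rho> b \<le> \<rho> a" for a b x y
  proof (cases "dist x y < \<rho> a / 2")
    case True
    have "y \<in> ball a (\<rho> a)" "x \<in> ball a (\<rho> a)"
      using ab True \<rho>(1)[OF ab(1)] dist_triangle[of a y x] by auto
    then have "dist (h x) (h y) \<le> c * dist x y" using lipschitz_onD[OF ballL[OF ab(1)]] by blast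
    also have "\<dots> \<le> 3 * c * dist x y" using c by (simp add: mult_right_mono)
    finally show ?thesis .
  next
    case False
    have xa: "dist a x \<le> dist x y / 2" "dist b y \<le> dist x y / 2" using False ab by auto
    then have "dist a b \<le> 2 * dist x y"
      using dist_triangle[of a b x] dist_triangle[of x b y] by (simp add: dist_commute)
    moreover have "dist (h x) (h y) \<le> dist (h a) (h x) + dist (h a) (h b) + dist (h b) (h y)"
      using dist_triangle[of "h x" "h y" "h a"] dist_triangle[of "h a" "h y" "h b"]
      by (simp add: dist_commute)
    moreover have "dist (h a) (h x) \<le> c * dist a x"
      using lipschitz_onD[OF ballL[OF ab(1)], of a x] ab \<rho>(1)[OF ab(1)] by auto
    moreover have "dist (h b) (h y) \<le> c * dist b y"
      using lipschitz_onD[OF ballL[OF ab(2)], of b y] ab \<rho>(1)[OF ab(2)] by auto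
    moreover have "dist (h a) (h b) \<le> c * dist a b"
      using lipschitz_onD[OF lip] ab by blast
    ultimately have "dist (h x) (h y) \<le> c * (dist a x + dist a b + dist b y)"
      by (simp add: algebra_simps)
    also have "\<dots> \<le> c * (3 * dist x y)"
      using xa \<open>dist a b \<le> 2 * dist x y\<close> c by (intro mult_left_mono) auto
    finally show ?thesis by simp
  qed
  show thesis
  proof (rule that[of W])
    show "open W" unfolding W_def by blast
    show "A \<subseteq> W" using \<rho>(1) by (force simp: W_def)
    show "(3 * c)-lipschitz_on W h"
    proof (rule lipschitz_onI)
      fix x y assume "x \<in> W" "y \<in> W"
      then obtain a b where ab: "a \<in> A" "b \<in> A" "x \<in> ball a (\<rho> a / 4)" "y \<in> ball b (\<rho> b / 4)"
        by (auto simp: W_def)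
      show "dist (h x) (h y) \<le> 3 * c * dist x y"
        using key[OF ab] key[OF ab(2,1,4,3)] by (cases "\<rho> b \<le> \<rho> a") (auto simp: dist_commute)
    qed (use c in simp)
    show "norm (h' x) \<le> c" if xW: "x \<in> W" for x
    proof -
      obtain a where "a \<in> A" "x \<in> ball a (\<rho> a / 4)" using xW by (auto simp: W_def)
      then have "x \<in> U" using \<rho>[of a] by auto
      then show ?thesis by (simp add: U_def)
    qed
  qed
qed

section \<open>The extension\<close>

text \<open>
  The mean value condition with its witness \<open>D\<close> as a parameter: near \<open>y\<close> the map
  \<open>f\<close> differs from a linear one by a map with small Lipschitz constant.
\<close>
definition mean_value_data ::
    "'a::real_normed_vector set \<Rightarrow> ('a \<Rightarrow> 'b::real_normed_vector) \<Rightarrow> ('a \<Rightarrow> 'a \<Rightarrow>\<^sub>L 'b) \<Rightarrow> bool"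
  where "mean_value_data A f D \<longleftrightarrow> continuous_on A D \<and>
    (\<forall>y\<in>A. \<forall>\<epsilon>>0. \<exists>r>0. \<epsilon>-lipschitz_on (A \<inter> ball y r) (\<lambda>z. f z - blinfun_apply (D y) z))"

lemma mean_value_condition_iff_data: "mean_value_condition A f \<longleftrightarrow> (\<exists>D. mean_value_data A f D)"
proof -
  have "\<epsilon>-lipschitz_on (A \<inter> ball y r) (\<lambda>z. f z - blinfun_apply (D y) z) \<longleftrightarrow>
      (\<forall>z \<in> A \<inter> ball y r. \<forall>w \<in> A \<inter> ball y r.
        norm (f z - f w - blinfun_apply (D y) (z - w)) \<le> \<epsilon> * norm (z - w))"
    if "\<epsilon> > 0" for \<epsilon> y r and D :: "'a \<Rightarrow> 'a \<Rightarrow>\<^sub>L 'b"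
    using that unfolding lipschitz_on_def dist_norm by (simp add: blinfun.diff_right algebra_simps)
  then show ?thesis unfolding mean_value_condition_def mean_value_data_def by simp
qed

lemma C1_on_imp_mean_value_data:
  assumes G: "C1_on UNIV G G'"
  shows "mean_value_data A G G'"
  unfolding mean_value_data_def
proof (intro conjI ballI allI impI)
  show "continuous_on A G'" using C1_onD(2)[OF G] by (rule continuous_on_subset) simp
  fix y :: 'a and \<epsilon> :: real assume "\<epsilon> > 0"
  obtain r where r: "r > 0" "\<And>x. dist x y < r \<Longrightarrow> dist (G' x) (G' y) < \<epsilon>"
    using C1_onD(2)[OF G] \<open>\<epsilon> > 0\<close> unfolding continuous_on_iff by blast
  have "C1_on (ball y r) (\<lambda>z. G z - blinfun_apply (G' y) z) (\<lambda>z. G' z - G' y)"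
    by (rule C1_on_diff[OF C1_on_subset[OF G] C1_on_blinfun_apply]) simp
  then have "\<epsilon>-lipschitz_on (ball y r) (\<lambda>z. G z - blinfun_apply (G' y) z)"
    using r(2) \<open>\<epsilon> > 0\<close>
    by (intro lipschitz_on_convex_of_derivative) (force simp: dist_norm norm_minus_commute)+
  then show "\<exists>r>0. \<epsilon>-lipschitz_on (A \<inter> ball y r) (\<lambda>z. G z - blinfun_apply (G' y) z)"
    using r(1) lipschitz_on_subset by blast
qed

lemma mean_value_data_diff:
  assumes "mean_value_data A f D" "mean_value_data A g E"
  shows "mean_value_data A (\<lambda>x. f x - g x) (\<lambda>x. D x - E x)"
  unfolding mean_value_data_def
proof (intro conjI ballI allI impI)
  show "continuous_on A (\<lambda>x. D x - E x)"
    using assms by (intro continuous_intros) (auto simp: mean_value_data_def)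
  fix y :: 'a and \<epsilon> :: real assume "y \<in> A" "\<epsilon> > 0"
  then obtain r s where r: "r > 0" "(\<epsilon> / 2)-lipschitz_on (A \<inter> ball y r) (\<lambda>z. f z - blinfun_apply (D y) z)"
    and s: "s > 0" "(\<epsilon> / 2)-lipschitz_on (A \<inter> ball y s) (\<lambda>z. g z - blinfun_apply (E y) z)"
    using assms half_gt_zero[OF \<open>\<epsilon> > 0\<close>] unfolding mean_value_data_def by metis
  have "(\<epsilon> / 2 + \<epsilon> / 2)-lipschitz_on (A \<inter> ball y (min r s))
      (\<lambda>z. (f z - blinfun_apply (D y) z) - (g z - blinfun_apply (E y) z))"
    by (intro lipschitz_on_diff lipschitz_on_subset[OF r(2)] lipschitz_on_subset[OF s(2)]) auto
  moreover have "(f z - blinfun_apply (D y) z) - (g z - blinfun_apply (E y) z) =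
      f z - g z - blinfun_apply (D y - E y) z" for z
    by (simp add: minus_blinfun.rep_eq)
  ultimately have "\<epsilon>-lipschitz_on (A \<inter> ball y (min r s)) (\<lambda>z. f z - g z - blinfun_apply (D y - E y) z)"
    by simp
  then show "\<exists>r>0. \<epsilon>-lipschitz_on (A \<inter> ball y r) (\<lambda>z. f z - g z - blinfun_apply (D y - E y) z)"
    using r(1) s(1) by (intro exI[of _ "min r s"]) auto
qed

text \<open>
  Near \<open>y \<in> A\<close> the map \<open>f - D y\<close> has Lipschitz constant at most \<open>\<epsilon>\<close> on \<open>A\<close>, so it has \<open>C\<^sup>1\<close> approximations
  with Lipschitz constant \<open>C * \<epsilon>\<close>. Adding \<open>D y\<close> back shows that \<open>f\<close> is approximable near \<open>y\<close>;
  off the closed set \<open>A\<close> there is nothing to approximate.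
\<close>
lemma C1_approximation_on_closed:
  fixes f :: "'a::banach \<Rightarrow> 'b::banach" and e :: 'b
  assumes C: "lipschitz_smoothing C TYPE('a) TYPE('b)" and "e \<noteq> 0" and "closed A"
    and f: "mean_value_data A f D" and "\<kappa> > 0"
  obtains h h' where "C1_on UNIV h h'" "\<And>x. x \<in> A \<Longrightarrow> norm (h x - f x) \<le> \<kappa>"
    "\<And>x. x \<in> A \<Longrightarrow> norm (h' x - D x) \<le> \<kappa>" "\<kappa>-lipschitz_on A (\<lambda>x. h x - f x)"
proof -
  have C1: "C \<ge> 1" using C by (simp add: lipschitz_smoothing_def)
  define \<epsilon> where "\<epsilon> = \<kappa> / 2 / (C + 1)"
  have \<epsilon>: "\<epsilon> > 0" "C * \<epsilon> + \<epsilon> = \<kappa> / 2"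
  proof -
    show "\<epsilon> > 0" using C1 \<open>\<kappa> > 0\<close> by (simp add: \<epsilon>_def)
    have "C * \<epsilon> + \<epsilon> = (C + 1) * \<epsilon>" by (simp add: algebra_simps)
    also have "\<dots> = \<kappa> / 2"
      using nonzero_mult_div_cancel_left[of "C + 1" "\<kappa> / 2"] C1
      by (simp only: \<epsilon>_def times_divide_eq_right)
    finally show "C * \<epsilon> + \<epsilon> = \<kappa> / 2" .
  qed
  have "approximable A A f D (\<lambda>_. \<kappa> / 2) (\<kappa> / 2) UNIV"
  proof (rule approximable_UNIV_if_locally[OF C \<open>e \<noteq> 0\<close>])
    fix y
    show "\<exists>U. open U \<and> y \<in> U \<and> approximable A A f D (\<lambda>_. \<kappa> / 2) (\<kappa> / 2) U"
    proof (cases "y \<in> A")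
      case False
      have "approximation_on A A f D (\<lambda>_. \<kappa> / 2) (\<kappa> / 2) (- A) \<delta> (\<lambda>_. 0) (\<lambda>_. 0)" if "\<delta> > 0" for \<delta>
        using that \<open>\<kappa> > 0\<close> C1_on_const[of "- A" 0] by (intro approximation_onI) auto
      then show ?thesis
        using False \<open>closed A\<close> by (intro exI[of _ "- A"]) (auto simp: approximable_def open_Compl)
    next
      case True
      obtain r1 where r1: "r1 > 0" "\<epsilon>-lipschitz_on (A \<inter> ball y r1) (\<lambda>z. f z - blinfun_apply (D y) z)"
        using f True \<epsilon>(1) unfolding mean_value_data_def by blast
      obtain r2 where r2: "r2 > 0" "\<And>x. x \<in> A \<Longrightarrow> dist x y < r2 \<Longrightarrow> dist (D x) (D y) < \<epsilon>"
        using f True \<epsilon>(1) unfolding mean_value_data_def continuous_on_iff by blast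
      define U where "U = ball y (min r1 r2)"
      have U: "open U" "y \<in> U" using r1 r2 by (auto simp: U_def)
      have lip: "\<epsilon>-lipschitz_on (A \<inter> U) (\<lambda>z. f z - blinfun_apply (D y) z)"
        by (rule lipschitz_on_subset[OF r1(2)]) (auto simp: U_def)
      have "\<exists>u u'. approximation_on A A f D (\<lambda>_. \<kappa> / 2) (\<kappa> / 2) U \<delta> u u'" if "\<delta> > 0" for \<delta>
      proof -
        obtain g g' where g: "C1_on UNIV g g'" "(C * \<epsilon>)-lipschitz_on UNIV g"
          "\<And>x. x \<in> A \<inter> U \<Longrightarrow> norm (g x - (f x - blinfun_apply (D y) x)) \<le> \<delta>"
          by (rule lipschitz_smoothingE[OF C lip \<open>\<delta> > 0\<close>]) blast
        have "approximation_on A A f D (\<lambda>_. \<kappa> / 2) (\<kappa> / 2) U \<delta>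
            (\<lambda>x. g x + blinfun_apply (D y) x) (\<lambda>x. g' x + D y)"
        proof (rule approximation_onI)
          show "C1_on U (\<lambda>x. g x + blinfun_apply (D y) x) (\<lambda>x. g' x + D y)"
            by (rule C1_on_add[OF C1_on_subset[OF g(1)] C1_on_blinfun_apply]) simp
          show "norm (g x + blinfun_apply (D y) x - f x) \<le> \<delta>" if "x \<in> A" "x \<in> U" for x
            using g(3)[of x] that by (simp add: algebra_simps)
          show "norm (g' x + D y - D x) \<le> \<kappa> / 2 + \<delta>" if "x \<in> A" "x \<in> U" for x
          proof -
            have "norm (g' x) \<le> C * \<epsilon>"
              by (rule norm_derivative_le_lipschitz[OF g(2) open_UNIV UNIV_I C1_onD(1)[OF g(1) UNIV_I]])
            moreover have "norm (D y - D x) \<le> \<epsilon>"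
              using r2(2)[of x] that by (auto simp: U_def dist_commute dist_norm norm_minus_commute)
            moreover have "norm (g' x + D y - D x) \<le> norm (g' x) + norm (D y - D x)"
              using norm_triangle_ineq[of "g' x" "D y - D x"] by (simp add: algebra_simps)
            ultimately show ?thesis using \<epsilon>(2) \<open>\<delta> > 0\<close> by linarith
          qed
          have "(C * \<epsilon> + \<epsilon>)-lipschitz_on (A \<inter> U) (\<lambda>x. g x - (f x - blinfun_apply (D y) x))"
            by (rule lipschitz_on_diff[OF lipschitz_on_subset[OF g(2)] lip]) simp
          then have "(\<kappa> / 2)-lipschitz_on (A \<inter> U) (\<lambda>x. g x + blinfun_apply (D y) x - f x)"
            unfolding \<epsilon>(2) by (rule lipschitz_on_transform) simp
          then show "(\<kappa> / 2 + \<delta>)-lipschitz_on (A \<inter> U) (\<lambda>x. g x + blinfun_apply (D y) x - f x)"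
            by (rule lipschitz_on_mono) (use \<open>\<delta> > 0\<close> in auto)
        qed
        then show ?thesis by blast
      qed
      then show ?thesis using U by (auto simp: approximable_def)
    qed
  qed (use \<open>\<kappa> > 0\<close> in auto)
  then obtain h h' where "approximation_on A A f D (\<lambda>_. \<kappa> / 2) (\<kappa> / 2) UNIV (\<kappa> / 2) h h'"
    by (rule approximableE[where \<delta> = "\<kappa> / 2"]) (use \<open>\<kappa> > 0\<close> in simp)
  note h = approximation_onD[OF this]
  show thesis
  proof (rule that[of h h'])
    show "C1_on UNIV h h'" by (rule h(1))
    show "norm (h x - f x) \<le> \<kappa>" "norm (h' x - D x) \<le> \<kappa>" if "x \<in> A" for x
      using h(2,3)[OF that] \<open>\<kappa> > 0\<close> by auto
    show "\<kappa>-lipschitz_on A (\<lambda>x. h x - f x)" using h(4) by simp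
  qed
qed

text \<open>
  The step of the iteration; the point is the bound on \<open>H'\<close> over the whole space. Take first \<open>h\<close> as in
  the preceding lemma. It is Lipschitz with a constant comparable to \<open>\<eta>\<close> on an open set
  \<open>W\<close> around \<open>A\<close>, so its restriction to \<open>W\<close> has an extension \<open>F\<close> to the whole space with a constant
  of the same order. Now \<open>F\<close> is approximable everywhere: by \<open>h\<close> itself near \<open>A\<close>, with no error at
  all, and by smoothings of \<open>F\<close> off \<open>A\<close>. The resulting \<open>H\<close> has derivative of order \<open>\<eta>\<close> everywhere
  and is as close to \<open>f\<close> on \<open>A\<close> as \<open>h\<close> is, up to \<open>\<eta> / 4\<close>. In the bound, \<open>66 * C * C\<close> is the
  product of the factors \<open>2\<close> for \<open>h\<close> on \<open>A\<close>, \<open>3\<close> for \<open>h\<close> on \<open>W\<close>, \<open>11 * C\<close> for the extension and \<open>C\<close> for the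
  smoothing.
\<close>
lemma controlled_C1_approximation:
  fixes f :: "'a::banach \<Rightarrow> 'b::banach" and e :: 'b
  assumes C: "lipschitz_smoothing C TYPE('a) TYPE('b)" and "e \<noteq> 0" and "closed A"
    and f: "mean_value_data A f D" and "\<eta> > 0" and fL: "\<eta>-lipschitz_on A f"
    and D: "\<And>x. x \<in> A \<Longrightarrow> norm (D x) \<le> \<eta>"
  obtains H H' where "C1_on UNIV H H'" "\<And>x. norm (H' x) \<le> (66 * C * C + 1) * \<eta>"
    "\<And>x. x \<in> A \<Longrightarrow> norm (f x - H x) \<le> \<eta> / 2"
    "\<And>x. x \<in> A \<Longrightarrow> norm (D x - H' x) \<le> \<eta> / 2"
    "(\<eta> / 2)-lipschitz_on A (\<lambda>x. f x - H x)"
proof -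
  have C1: "C \<ge> 1" using C by (simp add: lipschitz_smoothing_def)
  obtain h h' where h: "C1_on UNIV h h'" "\<And>x. x \<in> A \<Longrightarrow> norm (h x - f x) \<le> \<eta> / 4"
    "\<And>x. x \<in> A \<Longrightarrow> norm (h' x - D x) \<le> \<eta> / 4" "(\<eta> / 4)-lipschitz_on A (\<lambda>x. h x - f x)"
    by (rule C1_approximation_on_closed[OF C \<open>e \<noteq> 0\<close> \<open>closed A\<close> f, of "\<eta> / 4"]) (use \<open>\<eta> > 0\<close> in auto)
  have "(\<eta> / 4 + \<eta>)-lipschitz_on A (\<lambda>x. (h x - f x) + f x)"
    by (rule lipschitz_on_add[OF h(4) fL])
  then have hA: "(2 * \<eta>)-lipschitz_on A h"
    by (rule lipschitz_on_mono[OF lipschitz_on_transform]) (use \<open>\<eta> > 0\<close> in auto)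
  have h'A: "norm (h' x) \<le> \<eta> / 4 + \<eta>" if "x \<in> A" for x
    using norm_triangle_ineq[of "h' x - D x" "D x"] h(3)[OF that] D[OF that] by simp
  have "norm (h' x) < 2 * \<eta>" if "x \<in> A" for x
    using h'A[OF that] \<open>\<eta> > 0\<close> by linarith
  then obtain W where W: "open W" "A \<subseteq> W" "(3 * (2 * \<eta>))-lipschitz_on W h"
      "\<And>x. x \<in> W \<Longrightarrow> norm (h' x) \<le> 2 * \<eta>"
    using C1_lipschitz_near_set[OF h(1) hA] by blast
  obtain F where F: "(11 * C * (3 * (2 * \<eta>)))-lipschitz_on UNIV F" "\<And>x. x \<in> W \<Longrightarrow> F x = h x"
    by (rule lipschitz_extension[OF C W(3)]) (use \<open>\<eta> > 0\<close> in auto)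
  define B where "B = C * (11 * C * (3 * (2 * \<eta>)))"
  have B: "2 * \<eta> \<le> B"
  proof -
    have "1 * 1 \<le> C * C" using C1 by (intro mult_mono) auto
    then have "2 * 1 * \<eta> \<le> 66 * (C * C) * \<eta>" using \<open>\<eta> > 0\<close> by (intro mult_right_mono) auto
    then show ?thesis by (simp add: B_def algebra_simps)
  qed
  \<comment> \<open>Exact derivative \<open>h'\<close> on \<open>A\<close>, and only the bound \<open>B\<close> on the derivative elsewhere.\<close>
  define D2 where "D2 = (\<lambda>x. if x \<in> A then h' x else 0)"
  define \<kappa> where "\<kappa> = (\<lambda>x. if x \<in> A then 0 else B)"
  have "approximable UNIV A F D2 \<kappa> 0 UNIV"
  proof (rule approximable_UNIV_if_locally[OF C \<open>e \<noteq> 0\<close>])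
    fix y
    show "\<exists>U. open U \<and> y \<in> U \<and> approximable UNIV A F D2 \<kappa> 0 U"
    proof (cases "y \<in> A")
      case True
      have "approximation_on UNIV A F D2 \<kappa> 0 W \<delta> h h'" if "\<delta> > 0" for \<delta>
      proof (rule approximation_onI)
        show "C1_on W h h'" by (rule C1_on_subset[OF h(1)]) simp
        show "norm (h x - F x) \<le> \<delta>" if "x \<in> W" for x using F(2)[OF that] \<open>\<delta> > 0\<close> by simp
        show "norm (h' x - D2 x) \<le> \<kappa> x + \<delta>" if "x \<in> W" for x
          using W(4)[OF that] B \<open>\<delta> > 0\<close> by (auto simp: D2_def \<kappa>_def)
        show "(0 + \<delta>)-lipschitz_on (A \<inter> W) (\<lambda>x. h x - F x)"
          using F(2) \<open>\<delta> > 0\<close> by (intro lipschitz_onI) auto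
      qed
      then show ?thesis
        using True W(1,2) by (intro exI[of _ W]) (auto simp: approximable_def)
    next
      case False
      have "\<exists>u u'. approximation_on UNIV A F D2 \<kappa> 0 (- A) \<delta> u u'" if "\<delta> > 0" for \<delta>
      proof -
        obtain g g' where g: "C1_on UNIV g g'" "B-lipschitz_on UNIV g" "\<And>x. norm (g x - F x) \<le> \<delta>"
          unfolding B_def by (rule lipschitz_smoothingE[OF C F(1) \<open>\<delta> > 0\<close>]) blast
        have "norm (g' x) \<le> B" for x
          by (rule norm_derivative_le_lipschitz[OF g(2) open_UNIV UNIV_I C1_onD(1)[OF g(1) UNIV_I]])
        then have "approximation_on UNIV A F D2 \<kappa> 0 (- A) \<delta> g g'"
          using g(3) \<open>\<delta> > 0\<close> C1_on_subset[OF g(1)]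
          by (intro approximation_onI) (auto simp: D2_def \<kappa>_def add_increasing2)
        then show ?thesis by blast
      qed
      then show ?thesis
        using False \<open>closed A\<close> by (intro exI[of _ "- A"]) (auto simp: approximable_def open_Compl)
    qed
  qed (use B \<open>\<eta> > 0\<close> in \<open>auto simp: \<kappa>_def\<close>)
  then obtain H H' where "approximation_on UNIV A F D2 \<kappa> 0 UNIV (\<eta> / 4) H H'"
    by (rule approximableE[where \<delta> = "\<eta> / 4"]) (use \<open>\<eta> > 0\<close> in simp)
  note H = approximation_onD[OF this, simplified]
  have FA: "F x = h x" if "x \<in> A" for x using F(2) W(2) that by blast
  show thesis
  proof (rule that[of H H'])
    show "C1_on UNIV H H'" by (rule H(1))
    show "norm (H' x) \<le> (66 * C * C + 1) * \<eta>" for x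
    proof -
      have "norm (H' x) \<le> norm (D2 x) + (\<kappa> x + \<eta> / 4)"
        using norm_triangle_ineq[of "D2 x" "H' x - D2 x"] H(3)[of x] by simp
      also have "\<dots> \<le> B + \<eta>"
        using h'A[of x] B \<open>\<eta> > 0\<close> by (auto simp: D2_def \<kappa>_def)
      finally show ?thesis by (simp add: B_def algebra_simps)
    qed
    show "norm (f x - H x) \<le> \<eta> / 2" if "x \<in> A" for x
      using norm_triangle_ineq[of "h x - f x" "H x - h x"] h(2)[OF that] H(2)[of x] FA[OF that]
      by (simp add: norm_minus_commute)
    show "norm (D x - H' x) \<le> \<eta> / 2" if "x \<in> A" for x
      using norm_triangle_ineq[of "h' x - D x" "H' x - h' x"] h(3)[OF that] H(3)[of x] that
      by (simp add: norm_minus_commute D2_def \<kappa>_def)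
    have "(\<eta> / 4)-lipschitz_on A (\<lambda>x. H x - h x)"
      using H(4) by (rule lipschitz_on_transform) (simp add: FA)
    from lipschitz_on_minus[OF lipschitz_on_add[OF h(4) this]]
    show "(\<eta> / 2)-lipschitz_on A (\<lambda>x. f x - H x)"
      by (rule lipschitz_on_mono[OF lipschitz_on_transform]) auto
  qed
qed

text \<open>
  Subtract from \<open>f\<close> a first approximation \<open>h\<close>, which makes the remainder, its Lipschitz constant and its
  operators bounded by \<open>1\<close>. Then remove controlled approximations \<open>H n\<close>, each of which
  halves these three bounds. The derivatives of the \<open>H n\<close> are dominated by a geometric
  series on the whole space and the series of the \<open>H n\<close> converges on \<open>A\<close>, so it converges everywhere to a
  \<open>C\<^sup>1\<close> map.
\<close>
lemma C1_extension:
  fixes f :: "'a::banach \<Rightarrow> 'b::banach" and e :: 'b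
  assumes C: "lipschitz_smoothing C TYPE('a) TYPE('b)" and "e \<noteq> 0" and "closed A" and "A \<noteq> {}"
    and f: "mean_value_data A f D"
  obtains G G' where "C1_on UNIV G G'" "\<And>x. x \<in> A \<Longrightarrow> G x = f x"
proof -
  define K where "K = 66 * C * C + 1"
  define \<eta> where "\<eta> = (\<lambda>n. (1 / 2 :: real) ^ n)"
  have \<eta>: "\<eta> n > 0" "\<eta> (Suc n) = \<eta> n / 2" for n by (auto simp: \<eta>_def)
  obtain h h' where h: "C1_on UNIV h h'" "\<And>x. x \<in> A \<Longrightarrow> norm (h x - f x) \<le> 1"
    "\<And>x. x \<in> A \<Longrightarrow> norm (h' x - D x) \<le> 1" "1-lipschitz_on A (\<lambda>x. h x - f x)"
    by (rule C1_approximation_on_closed[OF C \<open>e \<noteq> 0\<close> \<open>closed A\<close> f, of 1]) auto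
  define P where "P = (\<lambda>n (\<phi> :: 'a \<Rightarrow> 'b, E). mean_value_data A \<phi> E \<and> (\<eta> n)-lipschitz_on A \<phi> \<and>
    (\<forall>x\<in>A. norm (\<phi> x) \<le> \<eta> n) \<and> (\<forall>x\<in>A. norm (E x) \<le> \<eta> n))"
  define Q where "Q = (\<lambda>n (\<phi> :: 'a \<Rightarrow> 'b, E) (\<psi>, E2). \<exists>H H'. C1_on UNIV H H' \<and> (\<forall>x. norm (H' x) \<le> K * \<eta> n) \<and>
    \<psi> = (\<lambda>x. \<phi> x - H x) \<and> E2 = (\<lambda>x. E x - H' x))"
  have "P 0 ((\<lambda>x. f x - h x), (\<lambda>x. D x - h' x))"
    using mean_value_data_diff[OF f C1_on_imp_mean_value_data[OF h(1)]] h(2,3)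
      lipschitz_on_minus[OF h(4)]
    by (simp add: P_def \<eta>_def norm_minus_commute)
  moreover have "\<exists>q. P (Suc n) q \<and> Q n p q" if "P n p" for p n
  proof -
    obtain \<phi> E where p: "p = (\<phi>, E)" by (cases p)
    have \<phi>: "mean_value_data A \<phi> E" "(\<eta> n)-lipschitz_on A \<phi>" "\<And>x. x \<in> A \<Longrightarrow> norm (E x) \<le> \<eta> n"
      using that by (auto simp: P_def p)
    obtain H H' where "C1_on UNIV H H'" "\<And>x. norm (H' x) \<le> K * \<eta> n"
      "\<And>x. x \<in> A \<Longrightarrow> norm (\<phi> x - H x) \<le> \<eta> n / 2"
      "\<And>x. x \<in> A \<Longrightarrow> norm (E x - H' x) \<le> \<eta> n / 2"
      "(\<eta> n / 2)-lipschitz_on A (\<lambda>x. \<phi> x - H x)"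
      unfolding K_def
      by (rule controlled_C1_approximation[OF C \<open>e \<noteq> 0\<close> \<open>closed A\<close> \<phi>(1) \<eta>(1) \<phi>(2,3)]) blast+
    then show ?thesis
      using mean_value_data_diff[OF \<phi>(1) C1_on_imp_mean_value_data]
      by (intro exI[of _ "((\<lambda>x. \<phi> x - H x), (\<lambda>x. E x - H' x))"]) (auto simp: P_def Q_def p \<eta>(2))
  qed
  ultimately obtain s where s: "\<And>n. P n (s n)" "\<And>n. Q n (s n) (s (Suc n))"
    and s0: "s 0 = ((\<lambda>x. f x - h x), (\<lambda>x. D x - h' x))"
    using dependent_nat_choice[of "\<lambda>n p. P n p \<and> (n = 0 \<longrightarrow> p = ((\<lambda>x. f x - h x), (\<lambda>x. D x - h' x)))" Q]
    by (metis nat.distinct(1))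
  define \<phi> where "\<phi> = (\<lambda>n. fst (s n))"
  have "\<exists>H H'. C1_on UNIV H H' \<and> (\<forall>x. norm (H' x) \<le> K * \<eta> n) \<and> (\<forall>x. \<phi> (Suc n) x = \<phi> n x - H x)" for n
    using s(2)[of n] by (auto simp: Q_def \<phi>_def split: prod.splits)
  then obtain H H' where H: "\<And>n. C1_on UNIV (H n) (H' n)" "\<And>n x. norm (H' n x) \<le> K * \<eta> n"
      "\<And>n x. \<phi> (Suc n) x = \<phi> n x - H n x"
    by metis
  have sumH: "(\<Sum>i<n. H i x) = f x - h x - \<phi> n x" for n x
  proof (induction n)
    case 0
    show ?case by (simp add: \<phi>_def s0)
  next
    case (Suc n)
    then show ?case by (simp add: H(3))
  qed
  have \<phi>0: "(\<lambda>n. \<phi> n x) \<longlonglongrightarrow> 0" if "x \<in> A" for x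
  proof (rule Lim_null_comparison)
    have "norm (\<phi> n x) \<le> \<eta> n" for n
      using s(1)[of n] that by (auto simp: P_def \<phi>_def split: prod.splits)
    then show "\<forall>\<^sub>F n in sequentially. norm (\<phi> n x) \<le> \<eta> n" by simp
    show "\<eta> \<longlonglongrightarrow> 0" unfolding \<eta>_def by (rule LIMSEQ_power_zero) simp
  qed
  have sumsA: "(\<lambda>n. H n x) sums (f x - h x)" if "x \<in> A" for x
    unfolding sums_def sumH using tendsto_diff[OF tendsto_const \<phi>0[OF that]] by simp
  define S where "S = (\<lambda>x. \<Sum>n. H' n x)"
  have "uniform_limit UNIV (\<lambda>n x. \<Sum>i<n. H' i x) S sequentially"
    unfolding S_def
  proof (rule Weierstrass_m_test)
    show "summable (\<lambda>n. K * \<eta> n)"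
      unfolding \<eta>_def by (intro summable_mult summable_geometric) simp
  qed (use H(2) in auto)
  note unif = this
  have "continuous_on UNIV S"
    using H(1) by (intro uniform_limit_theorem[OF _ unif] always_eventually)
      (auto intro!: continuous_on_sum simp: C1_on_def)
  obtain a where "a \<in> A" using \<open>A \<noteq> {}\<close> by blast
  have "\<exists>g. \<forall>x\<in>UNIV. (\<lambda>n. H n x) sums g x \<and> (g has_derivative blinfun_apply (S x)) (at x within UNIV)"
  proof (rule has_derivative_series[OF convex_UNIV])
    show "(H n has_derivative blinfun_apply (H' n x)) (at x within UNIV)" for n x
      using C1_onD(1)[OF H(1)] by simp
    show "(\<lambda>n. H n a) sums (f a - h a)" by (rule sumsA[OF \<open>a \<in> A\<close>])
    fix \<epsilon> :: real assume "\<epsilon> > 0"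
    have "\<forall>\<^sub>F n in sequentially. \<forall>x\<in>UNIV. dist (\<Sum>i<n. H' i x) (S x) < \<epsilon>"
      by (rule uniform_limitD[OF unif \<open>\<epsilon> > 0\<close>])
    then show "\<forall>\<^sub>F n in sequentially. \<forall>x\<in>UNIV. \<forall>v.
        norm ((\<Sum>i<n. blinfun_apply (H' i x) v) - blinfun_apply (S x) v) \<le> \<epsilon> * norm v"
    proof (rule eventually_mono, intro ballI allI)
      fix n x v assume *: "\<forall>x\<in>UNIV. dist (\<Sum>i<n. H' i x) (S x) < \<epsilon>"
      have "norm (blinfun_apply ((\<Sum>i<n. H' i x) - S x) v) \<le> norm ((\<Sum>i<n. H' i x) - S x) * norm v"
        by (rule norm_blinfun)
      also have "\<dots> \<le> \<epsilon> * norm v"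
        using * by (intro mult_right_mono) (auto simp: dist_norm less_imp_le)
      finally show "norm ((\<Sum>i<n. blinfun_apply (H' i x) v) - blinfun_apply (S x) v) \<le> \<epsilon> * norm v"
        by (simp add: blinfun.diff_left blinfun.sum_left)
    qed
  qed simp
  then obtain g where g: "\<And>x. (\<lambda>n. H n x) sums g x" "\<And>x. (g has_derivative blinfun_apply (S x)) (at x)"
    by auto
  have "C1_on UNIV (\<lambda>x. h x + g x) (\<lambda>x. h' x + S x)"
    using g(2) \<open>continuous_on UNIV S\<close> by (intro C1_on_add h(1)) (simp add: C1_on_def)
  moreover have "h x + g x = f x" if "x \<in> A" for x
    using sums_unique2[OF g(1) sumsA[OF that]] by simp
  ultimately show thesis using that by blast
qed

theorem theorem2p1:
  fixes A :: "'a::banach set" and f :: "'a \<Rightarrow> 'b::banach"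
  assumes "property_star TYPE('a) TYPE('b)"
    and "closed A"
  shows "mean_value_condition A f \<longleftrightarrow>
    (\<exists>G :: 'a \<Rightarrow> 'b. C1_smooth G \<and> (\<forall>x\<in>A. G x = f x))"
proof
  assume "mean_value_condition A f"
  then obtain D where D: "mean_value_data A f D" by (auto simp: mean_value_condition_iff_data)
  obtain C where C: "lipschitz_smoothing C TYPE('a) TYPE('b)"
    using property_star_imp_lipschitz_smoothing[OF assms(1)] .
  show "\<exists>G :: 'a \<Rightarrow> 'b. C1_smooth G \<and> (\<forall>x\<in>A. G x = f x)"
  proof (cases "A = {} \<or> (\<forall>e :: 'b. e = 0)")
    case True
    then have "\<forall>x\<in>A. 0 = f x" by auto
    moreover have "C1_smooth (\<lambda>_ :: 'a. 0 :: 'b)"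
      using C1_on_const by (auto simp: C1_smooth_iff_C1_on)
    ultimately show ?thesis by (intro exI[of _ "\<lambda>_. 0"]) simp
  next
    case False
    then obtain e :: 'b where "e \<noteq> 0" "A \<noteq> {}" by blast
    then obtain G G' where "C1_on UNIV G G'" "\<And>x. x \<in> A \<Longrightarrow> G x = f x"
      using C1_extension[OF C _ assms(2) _ D] by metis
    then show ?thesis by (auto simp: C1_smooth_iff_C1_on)
  qed
next
  assume "\<exists>G :: 'a \<Rightarrow> 'b. C1_smooth G \<and> (\<forall>x\<in>A. G x = f x)"
  then obtain G G' where G: "C1_on UNIV G G'" and eq: "\<And>x. x \<in> A \<Longrightarrow> G x = f x"
    by (auto simp: C1_smooth_iff_C1_on)
  have "mean_value_condition A G"
    using C1_on_imp_mean_value_data[OF G] by (auto simp: mean_value_condition_iff_data)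
  then show "mean_value_condition A f"
    unfolding mean_value_condition_def by (simp add: eq)
qed

end
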